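(* Let $K/\mathbb{Q}$ be a number field, $\mathfrak{p}$ a nonzero prime ideal of $\mathcal{O}_K$, and $T$ a nonempty set of nonzero prime ideals of $\mathcal{O}_K$. Then the arithmetic subderivative $D_{K,T}: K \to K$ is not strictly differentiable (with respect to the ultrametric absolute value $|\cdot|_{\nu_{\mathfrak{p}}}$) at $0$.
   Context: For a nonzero prime ideal $\mathfrak{q}$ of the ring of integers of a number field lying over the rational prime $q$, $\nu_{\mathfrak{q}}$ denotes the associated discrete valuation normalized to extend $\nu_q$, and for a finite Galois extension $L/\mathbb{Q}$, $g(q,L)$ is the number of prime ideals of $\mathcal{O}_L$ over $q$. For $L/\mathbb{Q}$ finite Galois and a set $T'$ of nonzero prime ideals of $\mathcal{O}_L$, $D_{L,T'}(0)=0$ and $D_{L,T'}(x) := x\sum_{\mathfrak{Q}\in T'} \frac{\nu_{\mathfrak{Q}}(x)}{q\,g(q,L)}$ for $x\ne 0$ ($q$ the prime below $\mathfrak{Q}$). For a number field $K$ and a set $T$ of prime ideals of $\mathcal{O}_K$, choose a finite extension $L/K$ with $L/\mathbb{Q}$ Galois, let $T_{L/K}$ be the prime ideals of $\mathcal{O}_L$ lying over elements of $T$, and define $D_{K,T}(x) := D_{L,T_{L/K}}(x)$ (independent of $L$). $|x|_{\nu_{\mathfrak{p}}} = c^{\nu_{\mathfrak{p}}(x)}$ for a fixed $0<c<1$. A function $f:K\to K$ is strictly differentiable at $x$ if $\frac{f(u)-f(v)}{u-v}$ has a limit as $(u,v) \to (x,x)$ with $u \neq v$. *)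

theory Defs
  imports
    Complex_Main
    "HOL-Algebra.Algebraic_Closure_Type"
    "HOL-Algebra.Ideal_Product"
begin

text \<open>
  Number fields are taken as subfields of an algebraically closed ambient field of
  characteristic 0 (for instance the complex numbers), so that every number field has its
  overfields that are Galois over the rationals available inside the same type.
\<close>

definition number_field :: "'a::{alg_closed_field,field_char_0} set \<Rightarrow> bool" where
  "number_field K \<longleftrightarrow>
     subfield K ring_of_type_algebra \<and> ring.finite_dimension ring_of_type_algebra \<rat> K"

definition ring_of_integers :: "'a::{alg_closed_field,field_char_0} set \<Rightarrow> 'a ring" where
  "ring_of_integers K = ring_of_type_algebra\<lparr>carrier := {x \<in> K. algebraic_int x}\<rparr>"

definition nonzero_primes :: "'a::{alg_closed_field,field_char_0} set \<Rightarrow> 'a set set" where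
  "nonzero_primes K = {P. primeideal P (ring_of_integers K) \<and> P \<noteq> {0}}"

text \<open>
  Normality and separability in one condition: every irreducible rational polynomial with a
  root in \<open>L\<close> is, up to a constant, a product of distinct linear factors over \<open>L\<close>.
\<close>

definition galois_over_rationals :: "'a::{alg_closed_field,field_char_0} set \<Rightarrow> bool" where
  "galois_over_rationals L \<longleftrightarrow>
     (\<forall>f :: rat poly. irreducible f \<and> (\<exists>x\<in>L. poly (map_poly of_rat f) x = 0) \<longrightarrow>
        (\<exists>c as. distinct as \<and> set as \<subseteq> L \<and>
           map_poly of_rat f = smult c (\<Prod>a\<leftarrow>as. [:- a, 1:])))"

definition rational_prime_below :: "'a::{alg_closed_field,field_char_0} set \<Rightarrow> nat" where
  "rational_prime_below P = (THE q. prime q \<and> of_nat q \<in> P)"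

definition num_primes_over :: "nat \<Rightarrow> 'a::{alg_closed_field,field_char_0} set \<Rightarrow> nat" where
  "num_primes_over q L = card {Q \<in> nonzero_primes L. of_nat q \<in> Q}"

definition primes_over ::
  "'a::{alg_closed_field,field_char_0} set \<Rightarrow> 'a set \<Rightarrow> 'a set set \<Rightarrow> 'a set set" where
  "primes_over L K T =
     {Q \<in> nonzero_primes L. Q \<inter> carrier (ring_of_integers K) \<in> T}"

text \<open>
  The \<open>P\<close>-adic order: on nonzero integers the largest \<open>n\<close> with \<open>x \<in> P\<^sup>n\<close>, extended to nonzero
  quotients \<open>a / b\<close> by additivity. The value at 0 (mathematically \<open>\<infinity>\<close>) is never used.
\<close>

definition ord_integer :: "'a::{alg_closed_field,field_char_0} set \<Rightarrow> 'a set \<Rightarrow> 'a \<Rightarrow> nat" where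
  "ord_integer K P x =
     (GREATEST n::nat. x \<in> P [^]\<^bsub>ideals_set (ring_of_integers K)\<^esub> n)"

definition prime_ord :: "'a::{alg_closed_field,field_char_0} set \<Rightarrow> 'a set \<Rightarrow> 'a \<Rightarrow> int" where
  "prime_ord K P x =
     (THE n. \<exists>a \<in> carrier (ring_of_integers K). \<exists>b \<in> carrier (ring_of_integers K).
        a \<noteq> 0 \<and> b \<noteq> 0 \<and> x = a / b \<and> n = int (ord_integer K P a) - int (ord_integer K P b))"

text \<open>
  Dividing by the ramification index, i.e. the order of the rational prime \<open>q\<close> below \<open>P\<close>,
  makes the valuation extend the \<open>q\<close>-adic one on the rationals.
\<close>

definition prime_val :: "'a::{alg_closed_field,field_char_0} set \<Rightarrow> 'a set \<Rightarrow> 'a \<Rightarrow> rat" where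
  "prime_val K P x =
     of_int (prime_ord K P x) / of_int (prime_ord K P (of_nat (rational_prime_below P)))"

definition prime_abs ::
  "real \<Rightarrow> 'a::{alg_closed_field,field_char_0} set \<Rightarrow> 'a set \<Rightarrow> 'a \<Rightarrow> real" where
  "prime_abs c K P x = (if x = 0 then 0 else c powr of_rat (prime_val K P x))"

text \<open>
  \<open>T\<close> may be infinite; the sum has only finitely many nonzero terms and is restricted to them.
\<close>

definition galois_subderivative ::
  "'a::{alg_closed_field,field_char_0} set \<Rightarrow> 'a set set \<Rightarrow> 'a \<Rightarrow> 'a" where
  "galois_subderivative L T x =
     (if x = 0 then 0
      else x * (\<Sum>Q \<in> {Q \<in> T. prime_val L Q x \<noteq> 0}.
        of_rat (prime_val L Q x /
          of_nat (rational_prime_below Q * num_primes_over (rational_prime_below Q) L))))"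

definition galois_overfield :: "'a::{alg_closed_field,field_char_0} set \<Rightarrow> 'a set" where
  "galois_overfield K = (SOME L. number_field L \<and> K \<subseteq> L \<and> galois_over_rationals L)"

definition arithmetic_subderivative ::
  "'a::{alg_closed_field,field_char_0} set \<Rightarrow> 'a set set \<Rightarrow> 'a \<Rightarrow> 'a" where
  "arithmetic_subderivative K T =
     galois_subderivative (galois_overfield K) (primes_over (galois_overfield K) K T)"

definition strictly_differentiable_at ::
  "'a::field set \<Rightarrow> ('a \<Rightarrow> real) \<Rightarrow> ('a \<Rightarrow> 'a) \<Rightarrow> 'a \<Rightarrow> bool" where
  "strictly_differentiable_at K N f x \<longleftrightarrow>
     (\<exists>l\<in>K. \<forall>\<epsilon>>0. \<exists>\<delta>>0. \<forall>u\<in>K. \<forall>v\<in>K.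
        u \<noteq> v \<and> N (u - x) < \<delta> \<and> N (v - x) < \<delta> \<longrightarrow> N ((f u - f v) / (u - v) - l) < \<epsilon>)"

end

theory Submission
  imports Defs "Jordan_Normal_Form.Char_Poly"
begin

text \<open>
  On a rational number \<open>x\<close> the subderivative is \<open>x * (\<Sum>q. \<alpha>\<^sub>q * \<nu>\<^sub>q x)\<close> with rational weights \<open>\<alpha>\<^sub>q \<ge> 0\<close>,
  where \<open>\<alpha>\<^sub>q > 0\<close> iff some prime of \<open>T\<close> lies over \<open>q\<close>. Let \<open>p\<close> lie under \<open>P\<close>. There are two families of
  pairs of rationals tending \<open>p\<close>-adically to 0 along which the difference quotient is constant, with
  different constants, so that no strict derivative exists. If \<open>\<alpha>\<^sub>q > 0\<close> for some \<open>q \<noteq> p\<close>, compare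
  \<open>p ^ n * q ^ (j - m)\<close> with 0, where \<open>n * \<alpha>\<^sub>p = m * \<alpha>\<^sub>q\<close>: the quotient is \<open>j * \<alpha>\<^sub>q\<close>. Otherwise compare
  \<open>p ^ n + p ^ (n + k)\<close> with \<open>p ^ (n + k)\<close>, where \<open>n = k * p ^ k + e\<close>: the quotient is \<open>e * \<alpha>\<^sub>p\<close>.

  The arithmetic of number fields behind this rests on one fact: more than \<open>[K:\<rat>]\<close> integers of \<open>K\<close> are
  linearly dependent modulo every rational prime. Hence residue rings are finite, which gives finitely
  many primes over \<open>q\<close>, and by pigeonhole the local invertibility of prime ideals.
\<close>

section \<open>Algebraic integers form a ring\<close>

text \<open>On a rational number every normalized valuation over a prime \<open>q\<close> equals the
  \<open>q\<close>-adic one, so only the total weight of the primes over \<open>q\<close> enters.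
  The difference quotients are made exactly constant, not merely convergent, so that comparing them
  with a derivative takes no more than positivity of the absolute value off 0. In the second family
  the quotient is \<open>\<alpha>\<^sub>p * (n - k * p ^ k)\<close>, which explains the shift by
  \<open>k * p ^ k\<close> in \<open>n\<close>.

  The main obstacle is that orders are defined through the largest ideal power containing an
  element, and their additivity needs ideal arithmetic. It comes from one element \<open>y\<close>
  of \<open>K\<close> such that \<open>y * P\<close> consists of integers but is not inside
  \<open>P\<close>: the \<open>n\<close>-th power of \<open>P\<close> is the set of integers
  \<open>x\<close> with \<open>y ^ n * x\<close> integral, so the order counts how often
  \<open>x\<close> may be multiplied by \<open>y\<close>. Such a \<open>y\<close> also shows that
  every prime of \<open>K\<close> has a prime of the larger field over it, so that some weight is
  positive. The larger field is fixed by a choice operator, hence the existence of Galois closures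
  is part of the proof.\<close>

lemma algebraic_int_if_eigenvalue:
  fixes z :: "'a::field_char_0" and e :: "nat \<Rightarrow> 'a" and A :: "nat \<Rightarrow> nat \<Rightarrow> int"
  assumes ev: "\<And>i. i < n \<Longrightarrow> z * e i = (\<Sum>j<n. of_int (A i j) * e j)"
    and nz: "k < n" "e k \<noteq> 0"
  shows "algebraic_int z"
proof -
  define M where "M = mat n n (\<lambda>(i, j). A i j)"
  have M: "M \<in> carrier_mat n n"
    by (simp add: M_def)
  define v where "v = vec n e"
  have "eigenvector (map_mat of_int M) v z"
    unfolding eigenvector_def
  proof (intro conjI)
    show "v \<in> carrier_vec (dim_row (map_mat of_int M))"
      by (simp add: v_def M_def)
    show "v \<noteq> 0\<^sub>v (dim_row (map_mat of_int M))"
      using nz by (auto simp: v_def M_def vec_eq_iff)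
    show "map_mat of_int M *\<^sub>v v = z \<cdot>\<^sub>v v"
    proof (rule eq_vecI)
      fix i assume "i < dim_vec (z \<cdot>\<^sub>v v)"
      then have i: "i < n"
        by (simp add: v_def)
      show "(map_mat of_int M *\<^sub>v v) $ i = (z \<cdot>\<^sub>v v) $ i"
        using ev[OF i] i by (simp add: v_def M_def scalar_prod_def atLeast0LessThan)
    qed (simp add: v_def M_def)
  qed
  then have "eigenvalue (map_mat of_int M) z"
    by (auto simp: eigenvalue_def)
  then have "poly (char_poly (map_mat of_int M)) z = 0"
    using eigenvalue_root_char_poly[of "map_mat of_int M" n z] M by simp
  then have "poly (map_poly of_int (char_poly M)) z = 0"
    by (simp add: of_int_hom.char_poly_hom[OF M])
  then show ?thesis
    using degree_monic_char_poly[OF M] unfolding algebraic_int_altdef_ipoly by blast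
qed

definition int_span :: "'a::field_char_0 set \<Rightarrow> 'a set" where
  "int_span B = range (\<lambda>c. \<Sum>b\<in>B. of_int (c b) * b)"

lemma int_span_add: "x \<in> int_span B \<Longrightarrow> y \<in> int_span B \<Longrightarrow> x + y \<in> int_span B"
  unfolding int_span_def
proof clarify
  fix c d :: "'a \<Rightarrow> int"
  show "(\<Sum>b\<in>B. of_int (c b) * b) + (\<Sum>b\<in>B. of_int (d b) * b)
      \<in> range (\<lambda>c. \<Sum>b\<in>B. of_int (c b) * b)"
    by (rule image_eqI[of _ _ "\<lambda>b. c b + d b"]) (simp_all add: sum.distrib algebra_simps)
qed

lemma int_span_scale: "x \<in> int_span B \<Longrightarrow> of_int m * x \<in> int_span B"
  unfolding int_span_def
proof clarify
  fix c :: "'a \<Rightarrow> int"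
  show "of_int m * (\<Sum>b\<in>B. of_int (c b) * b) \<in> range (\<lambda>c. \<Sum>b\<in>B. of_int (c b) * b)"
    by (rule image_eqI[of _ _ "\<lambda>b. m * c b"]) (simp_all add: sum_distrib_left algebra_simps)
qed

lemma int_span_0: "0 \<in> int_span B"
  unfolding int_span_def by (rule image_eqI[of _ _ "\<lambda>_. 0"]) simp_all

lemma int_span_sum: "(\<And>i. i \<in> I \<Longrightarrow> f i \<in> int_span B) \<Longrightarrow> sum f I \<in> int_span B"
  by (induction I rule: infinite_finite_induct) (auto simp: int_span_0 int_span_add)

lemma int_span_base:
  assumes "finite B" "x \<in> B"
  shows "x \<in> int_span B"
proof -
  have "(\<Sum>b\<in>B. of_int (if b = x then 1 else 0) * b) = (\<Sum>b\<in>B. if b = x then b else 0)"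
    by (rule sum.cong) auto
  also have "\<dots> = x"
    using assms by simp
  finally show ?thesis
    unfolding int_span_def by (intro image_eqI[of _ _ "\<lambda>b. if b = x then 1 else 0"]) simp_all
qed

lemma int_span_mult:
  assumes "\<And>b. b \<in> B \<Longrightarrow> z * b \<in> int_span B" "x \<in> int_span B"
  shows "z * x \<in> int_span B"
proof -
  obtain c where x: "x = (\<Sum>b\<in>B. of_int (c b) * b)"
    using assms(2) by (auto simp: int_span_def)
  have "z * x = (\<Sum>b\<in>B. of_int (c b) * (z * b))"
    by (simp add: x sum_distrib_left algebra_simps)
  then show ?thesis
    using assms(1) by (auto intro!: int_span_sum int_span_scale)
qed

text \<open>Multiplication by \<open>z\<close> acts on the generators through an integer matrix, and
  the vector of generators, nonzero because of \<open>b0\<close>, is an eigenvector of it for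
  \<open>z\<close>. The characteristic polynomial of an integer matrix is monic with integer
  coefficients.\<close>

lemma algebraic_int_if_stable:
  assumes B: "finite B" "b0 \<in> B" "b0 \<noteq> 0"
    and st: "\<And>b. b \<in> B \<Longrightarrow> z * b \<in> int_span B"
  shows "algebraic_int z"
proof -
  obtain e :: "nat \<Rightarrow> 'a" and n where e: "bij_betw e {..<n} B"
    using ex_bij_betw_nat_finite[OF B(1)] by (auto simp: atLeast0LessThan)
  have "\<exists>c. z * b = (\<Sum>b'\<in>B. of_int (c b') * b')" if "b \<in> B" for b
    using st[OF that] by (auto simp: int_span_def)
  then obtain c where c: "\<And>b. b \<in> B \<Longrightarrow> z * b = (\<Sum>b'\<in>B. of_int (c b b') * b')"
    by metis
  obtain k where k: "k < n" "e k = b0"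
    using e B(2) by (auto simp: bij_betw_def)
  show ?thesis
  proof (rule algebraic_int_if_eigenvalue[of n z e "\<lambda>i j. c (e i) (e j)"])
    fix i assume "i < n"
    then have "e i \<in> B"
      using e by (auto simp: bij_betw_def)
    then show "z * e i = (\<Sum>j<n. of_int (c (e i) (e j)) * e j)"
      using sum.reindex_bij_betw[OF e, of "\<lambda>b'. of_int (c (e i) b') * b'"] c by simp
  qed (use k B in auto)
qed

lemma algebraic_int_power_reduction:
  fixes x :: "'a::field_char_0"
  assumes "algebraic_int x"
  obtains m :: nat and c :: "nat \<Rightarrow> int"
  where "m > 0" "x ^ m = (\<Sum>k<m. of_int (c k) * x ^ k)"
proof -
  obtain p where p: "poly (map_poly of_int p) x = 0" "Polynomial.lead_coeff p = 1"
    using assms unfolding algebraic_int_altdef_ipoly by blast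
  define m where "m = Polynomial.degree p"
  have m: "m > 0"
  proof (rule ccontr)
    assume "\<not> m > 0"
    then have "p = [:1:]"
      using p(2) by (metis degree_eq_zeroE coeff_pCons_0 m_def neq0_conv)
    then show False
      using p(1) by (simp add: map_poly_pCons)
  qed
  have "0 = (\<Sum>k\<le>m. of_int (Polynomial.coeff p k) * x ^ k)"
    using p(1) by (simp add: poly_altdef degree_map_poly m_def coeff_map_poly)
  also have "{..m} = insert m {..<m}"
    by auto
  also have "(\<Sum>k\<in>insert m {..<m}. of_int (Polynomial.coeff p k) * x ^ k) =
      x ^ m + (\<Sum>k<m. of_int (Polynomial.coeff p k) * x ^ k)"
    using p(2) by (simp add: m_def)
  finally have "x ^ m = (\<Sum>k<m. of_int (- Polynomial.coeff p k) * x ^ k)"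
    by (simp add: sum_negf eq_neg_iff_add_eq_0 algebra_simps)
  then show ?thesis
    by (rule that[OF m])
qed

text \<open>The monomials \<open>x ^ i * y ^ j\<close> with exponents below the degrees
  \<open>m\<close> and \<open>n\<close> of monic relations span a group stable under
  \<open>x\<close> and \<open>y\<close>: only a top exponent overflows, and its relation brings it
  down. Stability passes to sum and product.\<close>

lemma algebraic_int_plus_times:
  fixes x y :: "'a::field_char_0"
  assumes "algebraic_int x" "algebraic_int y"
  shows "algebraic_int (x + y)" "algebraic_int (x * y)"
proof -
  obtain m c where m: "m > 0" "x ^ m = (\<Sum>k<m. of_int (c k) * x ^ k)"
    using algebraic_int_power_reduction[OF assms(1)] by metis
  obtain n d where n: "n > 0" "y ^ n = (\<Sum>k<n. of_int (d k) * y ^ k)"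
    using algebraic_int_power_reduction[OF assms(2)] by metis
  define B where "B = (\<lambda>(i, j). x ^ i * y ^ j) ` ({..<m} \<times> {..<n})"
  have B: "finite B"
    by (simp add: B_def)
  have mem: "x ^ i * y ^ j \<in> int_span B" if "i < m" "j < n" for i j
    by (rule int_span_base[OF B]) (use that in \<open>auto simp: B_def\<close>)
  have one: "1 \<in> B"
    unfolding B_def by (rule image_eqI[of _ _ "(0, 0)"]) (use m n in auto)
  have x: "x * b \<in> int_span B" if b: "b \<in> B" for b
  proof -
    obtain i j where ij: "i < m" "j < n" "b = x ^ i * y ^ j"
      using b by (auto simp: B_def)
    show ?thesis
    proof (cases "Suc i < m")
      case True
      then show ?thesis
        using mem[OF True ij(2)] by (simp add: ij(3) mult.assoc)
    next
      case False
      then have "m = Suc i"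
        using ij by simp
      then have "x * b = x ^ m * y ^ j"
        by (simp add: ij(3))
      also have "\<dots> = (\<Sum>k<m. of_int (c k) * (x ^ k * y ^ j))"
        by (subst m(2)) (simp add: sum_distrib_right mult.assoc)
      also have "\<dots> \<in> int_span B"
        by (intro int_span_sum int_span_scale mem) (use ij in auto)
      finally show ?thesis .
    qed
  qed
  have y: "y * b \<in> int_span B" if b: "b \<in> B" for b
  proof -
    obtain i j where ij: "i < m" "j < n" "b = x ^ i * y ^ j"
      using b by (auto simp: B_def)
    show ?thesis
    proof (cases "Suc j < n")
      case True
      then show ?thesis
        using mem[OF ij(1) True] by (simp add: ij(3) mult_ac)
    next
      case False
      then have "n = Suc j"
        using ij by simp
      then have "y * b = x ^ i * y ^ n"
        by (simp add: ij(3))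
      also have "\<dots> = (\<Sum>k<n. of_int (d k) * (x ^ i * y ^ k))"
        by (subst n(2)) (simp add: sum_distrib_left mult_ac)
      also have "\<dots> \<in> int_span B"
        by (intro int_span_sum int_span_scale mem) (use ij in auto)
      finally show ?thesis .
    qed
  qed
  show "algebraic_int (x + y)"
    by (rule algebraic_int_if_stable[OF B one]) (simp_all add: distrib_right int_span_add x y)
  show "algebraic_int (x * y)"
    by (rule algebraic_int_if_stable[OF B one])
      (simp_all add: mult.assoc int_span_mult[OF x] y)
qed

section \<open>Finiteness of residue rings\<close>

lemma ring_of_type_algebra_simps [simp]:
  "carrier (ring_of_type_algebra :: 'a::field ring) = UNIV"
  "x \<otimes>\<^bsub>ring_of_type_algebra\<^esub> y = (x * y :: 'a)"
  "x \<oplus>\<^bsub>ring_of_type_algebra\<^esub> y = (x + y :: 'a)"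
  "\<one>\<^bsub>ring_of_type_algebra\<^esub> = (1 :: 'a)"
  "\<zero>\<^bsub>ring_of_type_algebra\<^esub> = (0 :: 'a)"
  by (simp_all add: ring_of_type_algebra_def)

lemma a_inv_ring_of_type_algebra [simp]: "\<ominus>\<^bsub>ring_of_type_algebra\<^esub> x = (- x :: 'a::field)"
proof -
  interpret R: field "ring_of_type_algebra :: 'a ring"
    by (rule field_from_type_algebra)
  show ?thesis
    using R.minus_equality[of "- x" x] by simp
qed

lemma m_inv_ring_of_type_algebra:
  assumes "x \<noteq> 0"
  shows "inv\<^bsub>ring_of_type_algebra\<^esub> x = inverse (x :: 'a::field)"
proof -
  interpret R: field "ring_of_type_algebra :: 'a ring"
    by (rule field_from_type_algebra)
  show ?thesis
    using R.inv_unique'[of x "inverse x"] assms by simp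
qed

lemma subring_type_iff:
  "subring H (ring_of_type_algebra :: 'a::field ring) \<longleftrightarrow>
     1 \<in> H \<and> (\<forall>x\<in>H. - x \<in> H) \<and> (\<forall>x\<in>H. \<forall>y\<in>H. x * y \<in> H) \<and> (\<forall>x\<in>H. \<forall>y\<in>H. x + y \<in> H)"
proof -
  interpret R: field "ring_of_type_algebra :: 'a ring"
    by (rule field_from_type_algebra)
  show ?thesis
    using R.subringI[of H] subringE[of H "ring_of_type_algebra :: 'a ring"] by auto
qed

lemma subfield_type_iff:
  "subfield K (ring_of_type_algebra :: 'a::field ring) \<longleftrightarrow>
     subring K ring_of_type_algebra \<and> (\<forall>x\<in>K. inverse x \<in> K)" (is "?L \<longleftrightarrow> ?R")
proof -
  interpret R: field "ring_of_type_algebra :: 'a ring"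
    by (rule field_from_type_algebra)
  show ?thesis
  proof
    assume L: ?L
    have sr: "subring K ring_of_type_algebra"
      by (rule subfieldE(1)[OF L])
    have "inverse x \<in> K" if "x \<in> K" for x
    proof (cases "x = 0")
      case False
      then show ?thesis
        using R.subfield_m_inv(1)[OF L, of x] that by (simp add: m_inv_ring_of_type_algebra)
    qed (use that in simp)
    with sr show ?R
      by blast
  next
    assume ?R
    then show ?L
      by (intro R.subfieldI') (auto simp: m_inv_ring_of_type_algebra)
  qed
qed

lemma subring_type_diff:
  assumes "subring H (ring_of_type_algebra :: 'a::field ring)" "x \<in> H" "y \<in> H"
  shows "x - y \<in> H"
  using assms unfolding subring_type_iff by (metis diff_conv_add_uminus)

lemma subring_type_power:
  assumes "subring H (ring_of_type_algebra :: 'a::field ring)" "x \<in> H"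
  shows "x ^ n \<in> H"
  using assms unfolding subring_type_iff by (induction n) auto

lemma subring_type_of_nat:
  assumes "subring H (ring_of_type_algebra :: 'a::field ring)"
  shows "of_nat n \<in> H"
proof (induction n)
  case 0
  show ?case
    using subringE(2)[OF assms] by simp
next
  case (Suc n)
  then show ?case
    using assms unfolding subring_type_iff by auto
qed

lemma subring_type_of_int:
  assumes "subring H (ring_of_type_algebra :: 'a::field ring)"
  shows "of_int n \<in> H"
  using assms subring_type_of_nat[OF assms]
  by (cases n rule: int_cases2) (auto simp: subring_type_iff)

lemma subring_type_sum:
  assumes "subring H (ring_of_type_algebra :: 'a::field ring)" "\<And>i. i \<in> I \<Longrightarrow> f i \<in> H"
  shows "sum f I \<in> H"
  using assms subringE(2)[OF assms(1)]
  by (induction I rule: infinite_finite_induct) (auto simp: subring_type_iff)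

lemma subfield_Rats: "subfield \<rat> (ring_of_type_algebra :: 'a::field_char_0 ring)"
  unfolding subfield_type_iff subring_type_iff by auto

lemma Rats_subset_subfield:
  assumes "subfield K (ring_of_type_algebra :: 'a::field_char_0 ring)"
  shows "\<rat> \<subseteq> K"
proof
  fix x :: 'a assume "x \<in> \<rat>"
  then obtain a b where x: "x = of_int a / of_int b"
    by (auto elim: Rats_cases')
  have K: "subring K ring_of_type_algebra" "\<forall>x\<in>K. inverse x \<in> K"
    using assms unfolding subfield_type_iff by auto
  have "of_int a * inverse (of_int b) \<in> K"
    using K subring_type_of_int[OF K(1)] unfolding subring_type_iff by blast
  then show "x \<in> K"
    by (simp add: x field_simps)
qed

section \<open>Rings of integers of number fields\<close>

lemma mem_ring_of_integers [simp]:
  "x \<in> carrier (ring_of_integers K) \<longleftrightarrow> x \<in> K \<and> algebraic_int x"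
  by (simp add: ring_of_integers_def)

lemma ring_of_integers_simps [simp]:
  "x \<otimes>\<^bsub>ring_of_integers K\<^esub> y = x * y"
  "x \<oplus>\<^bsub>ring_of_integers K\<^esub> y = x + y"
  "\<one>\<^bsub>ring_of_integers K\<^esub> = 1"
  "\<zero>\<^bsub>ring_of_integers K\<^esub> = 0"
  by (simp_all add: ring_of_integers_def)

lemma number_field_subring:
  assumes "number_field K"
  shows "subring K ring_of_type_algebra"
  using assms subfieldE(1) unfolding number_field_def by blast

lemma number_field_divide:
  assumes "number_field K" "x \<in> K" "y \<in> K"
  shows "x / y \<in> K"
proof -
  have "inverse y \<in> K"
    using assms unfolding number_field_def subfield_type_iff by blast
  then have "x * inverse y \<in> K"
    using assms number_field_subring[OF assms(1)] unfolding subring_type_iff by blast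
  then show ?thesis
    by (simp add: field_simps)
qed

lemma ring_of_integers_subring:
  assumes "number_field K"
  shows "subring (carrier (ring_of_integers K)) ring_of_type_algebra"
  using number_field_subring[OF assms] unfolding subring_type_iff
  by (auto simp: algebraic_int_plus_times)

lemma ring_of_integers_cring:
  assumes "number_field K"
  shows "cring (ring_of_integers K)"
proof -
  interpret R: field "ring_of_type_algebra :: 'a ring"
    by (rule field_from_type_algebra)
  have "ring_of_integers K = ring_of_type_algebra\<lparr>carrier := carrier (ring_of_integers K)\<rparr>"
    by (simp add: ring_of_integers_def)
  then show ?thesis
    using R.subcring_iff[of "carrier (ring_of_integers K)"]
      R.subcringI'[OF ring_of_integers_subring[OF assms]] by simp
qed

section \<open>Linear dependence with integer coefficients\<close>

lemma combine_type_eq_sum: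
  "length Ks = length Us \<Longrightarrow>
     ring.combine (ring_of_type_algebra :: 'a::field ring) Ks Us = (\<Sum>i<length Us. Ks ! i * Us ! i)"
proof -
  interpret R: field "ring_of_type_algebra :: 'a ring"
    by (rule field_from_type_algebra)
  show "length Ks = length Us \<Longrightarrow> R.combine Ks Us = (\<Sum>i<length Us. Ks ! i * Us ! i)"
  proof (induction Us arbitrary: Ks)
    case (Cons u Us)
    then obtain k Ks' where "Ks = k # Ks'" "length Ks' = length Us"
      by (auto simp: length_Suc_conv)
    then show ?case
      using Cons.IH[of Ks'] by (simp add: sum.lessThan_Suc_shift del: sum.lessThan_Suc)
  qed simp
qed

lemma common_denominator:
  fixes f :: "'b \<Rightarrow> 'a::field_char_0"
  assumes "finite A" "\<And>a. a \<in> A \<Longrightarrow> f a \<in> \<rat>"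
  shows "\<exists>D::int. D \<noteq> 0 \<and> (\<forall>a\<in>A. of_int D * f a \<in> \<int>)"
  using assms
proof (induction A rule: finite_induct)
  case (insert a A)
  then obtain D :: int where D: "D \<noteq> 0" "\<forall>a\<in>A. of_int D * f a \<in> \<int>"
    by auto
  have "f a \<in> \<rat>"
    using insert.prems by simp
  then obtain m n where mn: "f a = of_int m / of_int n" "n > 0"
    by (auto elim: Rats_cases')
  have "of_int (n * D) * f a = of_int (D * m)"
    using mn by simp
  moreover have "of_int (n * D) * f a' \<in> \<int>" if "a' \<in> A" for a'
    using D(2) that by (simp add: mult.assoc)
  ultimately have "\<forall>a'\<in>insert a A. of_int (n * D) * f a' \<in> \<int>"
    by (metis Ints_of_int insert_iff)
  then show ?case
    using D(1) mn(2) by (intro exI[of _ "n * D"]) auto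
qed (auto intro: exI[of _ 1])

text \<open>A list longer than the dimension is dependent over the rationals, and a common
  denominator turns its coefficients into integers.\<close>

lemma number_field_dependent:
  assumes "number_field K"
  obtains n :: nat where
    "\<And>m x. m > n \<Longrightarrow> (\<And>i. i < m \<Longrightarrow> x i \<in> K) \<Longrightarrow>
       \<exists>c::nat \<Rightarrow> int. (\<exists>i<m. c i \<noteq> 0) \<and> (\<Sum>i<m. of_int (c i) * x i) = 0"
proof -
  interpret R: field "ring_of_type_algebra :: 'a ring"
    by (rule field_from_type_algebra)
  obtain n where n: "R.dimension n \<rat> K"
    using assms unfolding number_field_def R.finite_dimension_def by blast
  show ?thesis
  proof (rule that[of n])
    fix m :: nat and x assume m: "m > n" and x: "\<And>i. i < m \<Longrightarrow> x i \<in> K"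
    have "R.dependent \<rat> (map x [0..<m])"
      using R.independent_length_le_dimension[OF subfield_Rats n, of "map x [0..<m]"] m x
      by (fastforce simp: image_subset_iff)
    then obtain Ks where Ks: "length Ks = m" "R.combine Ks (map x [0..<m]) = 0" "set Ks \<subseteq> \<rat>"
        "set Ks \<noteq> {0}"
      using R.dependent_imp_non_trivial_combine[OF subfield_Rats, of "map x [0..<m]"] by auto
    have sum: "(\<Sum>i<m. Ks ! i * x i) = 0"
      using Ks(2) by (subst (asm) combine_type_eq_sum) (simp_all add: Ks(1))
    obtain i where i: "i < m" "Ks ! i \<noteq> 0"
    proof -
      \<comment> \<open>\<open>set Ks \<noteq> {0}\<close> also holds for the empty list, which
        \<open>m > n\<close> excludes.\<close>
      have "set Ks \<noteq> {}"
        using Ks(1) m by auto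
      then have "\<not> set Ks \<subseteq> {0}"
        using Ks(4) by (simp add: subset_singleton_iff)
      then obtain k where "k \<in> set Ks" "k \<noteq> 0"
        by blast
      then show ?thesis
        using that Ks(1) by (auto simp: in_set_conv_nth)
    qed
    obtain D :: int where D: "D \<noteq> 0" "\<forall>i\<in>{..<m}. of_int D * Ks ! i \<in> \<int>"
      using common_denominator[of "{..<m}" "\<lambda>i. Ks ! i"] Ks(1,3) by (auto simp: subset_iff)
    then have "\<forall>i. \<exists>z. i < m \<longrightarrow> of_int D * Ks ! i = of_int z"
      by (auto elim!: Ints_cases)
    then obtain c where c: "\<And>i. i < m \<Longrightarrow> of_int D * Ks ! i = of_int (c i)"
      by metis
    have "(\<Sum>i<m. of_int (c i) * x i) = of_int D * (\<Sum>i<m. Ks ! i * x i)"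
      unfolding sum_distrib_left
      by (rule sum.cong) (auto simp flip: c simp: mult_ac)
    moreover have "c i \<noteq> 0"
      using c[OF i(1)] i(2) D(1) by auto
    ultimately show "\<exists>c::nat \<Rightarrow> int. (\<exists>i<m. c i \<noteq> 0) \<and> (\<Sum>i<m. of_int (c i) * x i) = 0"
      using sum i(1) by (intro exI[of _ c]) auto
  qed
qed

text \<open>Dividing an integer relation by the gcd of its coefficients leaves coprime coefficients,
  so the relation stays nontrivial modulo every prime.\<close>

lemma number_field_dependent_mod_prime:
  assumes "number_field K"
  obtains n :: nat where
    "\<And>m x q. m > n \<Longrightarrow> (\<And>i. i < m \<Longrightarrow> x i \<in> K) \<Longrightarrow> prime q \<Longrightarrow>
       \<exists>c::nat \<Rightarrow> int. (\<exists>i<m. \<not> int q dvd c i) \<and> (\<Sum>i<m. of_int (c i) * x i) = 0"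
proof -
  obtain n :: nat where n: "\<And>m x. m > n \<Longrightarrow> (\<And>i. i < m \<Longrightarrow> x i \<in> K) \<Longrightarrow>
       \<exists>c::nat \<Rightarrow> int. (\<exists>i<m. c i \<noteq> 0) \<and> (\<Sum>i<m. of_int (c i) * x i) = 0"
    using number_field_dependent[OF assms] by blast
  show ?thesis
  proof (rule that[of n])
    fix m q :: nat and x assume m: "m > n" and x: "\<And>i. i < m \<Longrightarrow> x i \<in> K" and q: "prime q"
    obtain c :: "nat \<Rightarrow> int" where "(\<exists>i<m. c i \<noteq> 0) \<and> (\<Sum>i<m. of_int (c i) * x i) = 0"
      using n[of m x, OF m x] ..
    then obtain k where c: "k < m" "c k \<noteq> 0" "(\<Sum>i<m. of_int (c i) * x i) = 0"
      by blast
    define g where "g = Gcd (c ` {..<m})"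
    have g: "g \<noteq> 0"
      using c(1,2) by (auto simp: g_def)
    have dvd: "g dvd c i" if "i < m" for i
      unfolding g_def by (rule Gcd_dvd) (use that in auto)
    define d where "d i = c i div g" for i
    have cd: "c i = g * d i" if "i < m" for i
      using dvd[OF that] by (simp add: d_def)
    have "\<exists>i<m. \<not> int q dvd d i"
    proof (rule ccontr)
      assume "\<not> ?thesis"
      then have "int q * g dvd c i" if "i < m" for i
        using that cd[of i] by (auto simp: mult.commute)
      then have "int q * g dvd g"
        unfolding g_def by (intro Gcd_greatest) auto
      then have "int q * g dvd 1 * g"
        by simp
      then have "int q dvd 1"
        unfolding dvd_mult_cancel_right using g by blast
      then show False
        using q by auto
    qed
    moreover have "of_int g * (\<Sum>i<m. of_int (d i) * x i) = (\<Sum>i<m. of_int (c i) * x i)"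
      unfolding sum_distrib_left by (rule sum.cong) (auto simp: cd)
    then have "(\<Sum>i<m. of_int (d i) * x i) = 0"
      using c(3) g by simp
    ultimately show "\<exists>c::nat \<Rightarrow> int. (\<exists>i<m. \<not> int q dvd c i) \<and> (\<Sum>i<m. of_int (c i) * x i) = 0"
      by blast
  qed
qed

text \<open>The length of a family of integers independent modulo \<open>q\<close> is bounded by
  \<open>n\<close>, so a longest one exists. By maximality it generates the ring modulo
  \<open>q\<close>, and its coefficients may be reduced to the range below \<open>q\<close>, which
  leaves finitely many representatives.\<close>

lemma finite_residues_mod_prime:
  assumes K: "number_field K" and q: "prime (q::nat)"
  defines "R \<equiv> carrier (ring_of_integers K)"
  shows "\<exists>F. finite F \<and> F \<subseteq> R \<and> (\<forall>x\<in>R. \<exists>f\<in>F. \<exists>z\<in>R. x = f + of_nat q * z)"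
proof -
  have R: "subring R ring_of_type_algebra"
    unfolding R_def by (rule ring_of_integers_subring[OF K])
  note R' = R[unfolded subring_type_iff]
  have RK: "R \<subseteq> K"
    by (auto simp: R_def)
  obtain n :: nat where n: "\<And>m x q. m > n \<Longrightarrow> (\<And>i. i < m \<Longrightarrow> x i \<in> K) \<Longrightarrow> prime q \<Longrightarrow>
       \<exists>c::nat \<Rightarrow> int. (\<exists>i<m. \<not> int q dvd c i) \<and> (\<Sum>i<m. of_int (c i) * x i) = 0"
    using number_field_dependent_mod_prime[OF K] by blast
  \<comment> \<open>Linear independence, over the field with \<open>q\<close> elements, of the
    classes in the residue ring modulo \<open>q\<close>, expressed without quotients.\<close>
  define indep where "indep m x \<longleftrightarrow> (\<forall>i<m. x i \<in> R) \<and>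
      (\<forall>c::nat \<Rightarrow> int. (\<exists>z\<in>R. (\<Sum>i<m. of_int (c i) * x i) = of_nat q * z) \<longrightarrow> (\<forall>i<m. int q dvd c i))"
    for m :: nat and x :: "nat \<Rightarrow> 'a"
  have zero: "0 \<in> R"
    by (simp add: R_def subringE(2)[OF number_field_subring[OF K], simplified])
  have bound: "m \<le> n" if "indep m x" for m x
  proof (rule ccontr)
    assume "\<not> m \<le> n"
    then have "m > n" by simp
    moreover have "x i \<in> K" if "i < m" for i
      using \<open>indep m x\<close> that RK by (auto simp: indep_def)
    ultimately obtain c :: "nat \<Rightarrow> int" where
      c: "\<exists>i<m. \<not> int q dvd c i" "(\<Sum>i<m. of_int (c i) * x i) = 0"
      using n[of m x q] q by blast
    have "\<exists>z\<in>R. (\<Sum>i<m. of_int (c i) * x i) = of_nat q * z"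
      using zero c(2) by (intro bexI[of _ 0]) auto
    then show False
      using that c(1) by (auto simp: indep_def)
  qed
  define m where "m = (GREATEST m. \<exists>x. indep m x)"
  have "\<exists>x. indep 0 x"
    by (auto simp: indep_def)
  then have "\<exists>x. indep m x"
    unfolding m_def by (rule GreatestI_nat[where b = n]) (use bound in blast)
  then obtain x where x: "indep m x" ..
  have max: "\<not> indep (Suc m) y" for y
  proof
    assume "indep (Suc m) y"
    then have "Suc m \<le> m"
      unfolding m_def by (intro Greatest_le_nat[where b = n]) (use bound in blast)+
    then show False by simp
  qed
  define F where "F = (\<lambda>a. \<Sum>i<m. of_int (a i) * x i) ` ({..<m} \<rightarrow>\<^sub>E {0..<int q})"
  have xR: "x i \<in> R" if "i < m" for i
    using x that by (auto simp: indep_def)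
  have sumR: "(\<Sum>i<m. of_int (c i) * x i) \<in> R" for c :: "nat \<Rightarrow> int"
    by (rule subring_type_sum[OF R]) (use R' subring_type_of_int[OF R] xR in auto)
  have "finite F"
    unfolding F_def by (intro finite_imageI finite_PiE) auto
  moreover have "F \<subseteq> R"
    unfolding F_def using sumR by auto
  moreover have "\<exists>f\<in>F. \<exists>z\<in>R. y = f + of_nat q * z" if y: "y \<in> R" for y
  proof -
    define x' where "x' = x(m := y)"
    have x'R: "x' i \<in> R" if "i < Suc m" for i
      using that xR y by (auto simp: x'_def)
    obtain c :: "nat \<Rightarrow> int" and z i0 where c: "(\<Sum>i<Suc m. of_int (c i) * x' i) = of_nat q * z" "z \<in> R"
        "i0 < Suc m" "\<not> int q dvd c i0"
      using max[of x'] x'R unfolding indep_def by blast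
    have "(\<Sum>i<m. of_int (c i) * x' i) = (\<Sum>i<m. of_int (c i) * x i)"
      by (rule sum.cong) (auto simp: x'_def)
    with c(1) have c1: "(\<Sum>i<m. of_int (c i) * x i) = of_nat q * z - of_int (c m) * y"
      by (simp add: x'_def algebra_simps)
    \<comment> \<open>Otherwise the term with \<open>y\<close> could be moved to the multiples of
      \<open>q\<close>, and independence of \<open>x\<close> would make every coefficient divisible
      by \<open>q\<close>.\<close>
    have "\<not> int q dvd c m"
    proof
      assume "int q dvd c m"
      then obtain e where e: "c m = int q * e"
        by blast
      have "(\<Sum>i<m. of_int (c i) * x i) = of_nat q * (z - of_int e * y)"
        using c1 by (simp add: e algebra_simps)
      moreover have "z - of_int e * y \<in> R"
        using R' c(2) y subring_type_of_int[OF R] subring_type_diff[OF R] by blast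
      ultimately have "\<forall>i<m. int q dvd c i"
        using x unfolding indep_def by blast
      then show False
        using c(3,4) \<open>int q dvd c m\<close> less_Suc_eq by auto
    qed
    then have "coprime (int q) (c m)"
      using q by (simp add: prime_imp_coprime)
    then obtain d e where de: "c m * d + int q * e = 1"
      using bezout_int[of "c m" "int q"] by (metis coprime_commute coprime_imp_gcd_eq_1 mult.commute)
    \<comment> \<open>\<open>d\<close> inverts \<open>c m\<close> modulo \<open>q\<close>, so
      solving for \<open>y\<close> produces the coefficients \<open>- d * c i\<close>;
      \<open>a\<close> and \<open>b\<close> are their remainders and quotients on division by
      \<open>q\<close>.\<close>
    define a where "a = (\<lambda>i. (- d * c i) mod int q)"
    define b where "b = (\<lambda>i. (- d * c i) div int q)"
    have ab: "of_int (- d * c i) = (of_int (a i) + of_nat q * of_int (b i) :: 'a)" for i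
    proof -
      have "- d * c i = a i + int q * b i"
        by (simp add: a_def b_def)
      then show ?thesis
        by (metis of_int_add of_int_mult of_int_of_nat_eq)
    qed
    have "y = of_int (c m * d + int q * e) * y"
      by (simp add: de)
    also have "\<dots> = of_int d * (of_int (c m) * y) + of_nat q * (of_int e * y)"
      by (simp add: algebra_simps)
    also have "of_int (c m) * y = of_nat q * z - (\<Sum>i<m. of_int (c i) * x i)"
      using c1 by simp
    also have "of_int d * (of_nat q * z - (\<Sum>i<m. of_int (c i) * x i)) =
        of_nat q * (of_int d * z) + (\<Sum>i<m. of_int (- d * c i) * x i)"
      by (simp add: algebra_simps sum_distrib_left sum_negf)
    also have "(\<Sum>i<m. of_int (- d * c i) * x i) =
        (\<Sum>i<m. of_int (a i) * x i) + of_nat q * (\<Sum>i<m. of_int (b i) * x i)"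
      unfolding ab by (simp add: algebra_simps sum.distrib sum_distrib_left)
    finally have yeq: "y = (\<Sum>i<m. of_int (a i) * x i) +
        of_nat q * (of_int d * z + (\<Sum>i<m. of_int (b i) * x i) + of_int e * y)"
      by (simp add: algebra_simps)
    have "(\<Sum>i<m. of_int (a i) * x i) = (\<Sum>i<m. of_int (restrict a {..<m} i) * x i)"
      by (rule sum.cong) auto
    moreover have "restrict a {..<m} \<in> {..<m} \<rightarrow>\<^sub>E {0..<int q}"
      using q prime_gt_0_nat[of q] by (auto simp: a_def)
    ultimately have "(\<Sum>i<m. of_int (a i) * x i) \<in> F"
      unfolding F_def by blast
    moreover have "of_int d * z + (\<Sum>i<m. of_int (b i) * x i) + of_int e * y \<in> R"
      using R' c(2) y subring_type_of_int[OF R] sumR by blast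
    ultimately show ?thesis
      using yeq by blast
  qed
  ultimately show ?thesis
    by blast
qed

text \<open>For \<open>N = q * M\<close>, a residue modulo \<open>q\<close> plus \<open>q\<close>
  times a residue modulo \<open>M\<close> represents a class modulo \<open>N\<close>, which reduces
  the claim to prime moduli.\<close>

lemma finite_residues:
  assumes K: "number_field K" and N: "N > (0::nat)"
  defines "R \<equiv> carrier (ring_of_integers K)"
  shows "\<exists>F. finite F \<and> F \<subseteq> R \<and> (\<forall>x\<in>R. \<exists>f\<in>F. \<exists>z\<in>R. x = f + of_nat N * z)"
  using N
proof (induction N rule: less_induct)
  case (less N)
  have R: "subring R ring_of_type_algebra"
    unfolding R_def by (rule ring_of_integers_subring[OF K])
  note R' = R[unfolded subring_type_iff]
  show ?case
  proof (cases "N = 1")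
    case True
    have "0 \<in> R"
      using subringE(2)[OF R] by simp
    then show ?thesis
      using True by (intro exI[of _ "{0}"]) auto
  next
    case False
    then obtain q where q: "prime q" "q dvd N"
      using prime_factor_nat by blast
    then obtain M where M: "N = q * M"
      by blast
    then have "M > 0" "M < N"
      using less.prems prime_gt_1_nat[OF q(1)] by auto
    then obtain F1 where F1: "finite F1" "F1 \<subseteq> R" "\<forall>x\<in>R. \<exists>f\<in>F1. \<exists>z\<in>R. x = f + of_nat M * z"
      using less.IH[OF \<open>M < N\<close> \<open>M > 0\<close>] by metis
    obtain F where F: "finite F" "F \<subseteq> R" "\<forall>x\<in>R. \<exists>f\<in>F. \<exists>z\<in>R. x = f + of_nat q * z"
      using finite_residues_mod_prime[OF K q(1)] unfolding R_def by blast
    define G where "G = (\<lambda>(f, f1). f + of_nat q * f1) ` (F \<times> F1)"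
    have "finite G"
      using F(1) F1(1) by (simp add: G_def)
    moreover have "G \<subseteq> R"
    proof -
      have "f + of_nat q * f1 \<in> R" if "f \<in> F" "f1 \<in> F1" for f f1
        using that F(2) F1(2) R' subring_type_of_nat[OF R] by blast
      then show ?thesis
        by (auto simp: G_def)
    qed
    moreover have "\<exists>f\<in>G. \<exists>z\<in>R. x = f + of_nat N * z" if x: "x \<in> R" for x
    proof -
      obtain f z where fz: "f \<in> F" "z \<in> R" "x = f + of_nat q * z"
        using F(3) x by blast
      obtain f1 w where fw: "f1 \<in> F1" "w \<in> R" "z = f1 + of_nat M * w"
        using F1(3) fz(2) by blast
      have "x = (f + of_nat q * f1) + of_nat N * w"
        by (simp add: fz(3) fw(3) M algebra_simps)
      moreover have "f + of_nat q * f1 \<in> G"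
        unfolding G_def using fz(1) fw(1) by force
      ultimately show ?thesis
        using fw(2) by blast
    qed
    ultimately show ?thesis
      by blast
  qed
qed

text \<open>Modulo \<open>N\<close>, two of the elements \<open>N * y ^ k\<close> agree; then \<open>y ^ j - y ^ i\<close> is integral.\<close>

lemma ring_of_integers_completely_closed:
  assumes K: "number_field K" and N: "N > (0::nat)"
    and y: "y \<in> K" "\<And>k. algebraic_int (of_nat N * y ^ k)"
  shows "algebraic_int y"
proof -
  define R where "R = carrier (ring_of_integers K)"
  have R: "subring R ring_of_type_algebra"
    unfolding R_def by (rule ring_of_integers_subring[OF K])
  obtain F where F: "finite F" "\<forall>x\<in>R. \<exists>f\<in>F. \<exists>z\<in>R. x = f + of_nat N * z"
    using finite_residues[OF K N] unfolding R_def by blast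
  have "of_nat N * y ^ k \<in> R" for k
    using y(2) number_field_subring[OF K] subring_type_power[OF number_field_subring[OF K] y(1)]
      subring_type_of_nat[OF number_field_subring[OF K]]
    by (auto simp: R_def subring_type_iff)
  then have "\<exists>f. f \<in> F \<and> (\<exists>z\<in>R. of_nat N * y ^ k = f + of_nat N * z)" for k
    using F(2) by blast
  then obtain f where f: "\<And>k. f k \<in> F" "\<And>k. \<exists>z\<in>R. of_nat N * y ^ k = f k + of_nat N * z"
    by metis
  have "\<not> inj f"
    using f(1) F(1) by (metis finite_subset image_subsetI infinite_UNIV_nat finite_imageD)
  then obtain i j where "i < j" "f i = f j"
    by (metis injI linorder_neqE_nat)
  moreover obtain z w where "z \<in> R" "w \<in> R"
      "of_nat N * y ^ i = f i + of_nat N * z" "of_nat N * y ^ j = f j + of_nat N * w"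
    using f(2) by metis
  ultimately have "of_nat N * (y ^ j - y ^ i) = of_nat N * (w - z)" "w - z \<in> R"
    by (simp_all add: algebra_simps subring_type_diff[OF R])
  then have int: "algebraic_int (y ^ j - y ^ i)"
    using N by (simp add: R_def)
  \<comment> \<open>Since \<open>i < j\<close>, \<open>p\<close> is monic with integer coefficients,
    and its value at \<open>y\<close> is integral.\<close>
  define p :: "'a poly" where "p = Polynomial.monom 1 j - Polynomial.monom 1 i"
  have deg: "Polynomial.degree p = j"
    unfolding p_def diff_conv_add_uminus using \<open>i < j\<close>
    by (subst degree_add_eq_left) (simp_all add: degree_monom_eq)
  have "\<forall>k. Polynomial.coeff p k \<in> \<int>"
    by (auto simp: p_def)
  then show ?thesis
    using \<open>i < j\<close> by (intro algebraic_int_root[OF int, of p])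
      (auto simp: deg, auto simp: p_def poly_monom)
qed

section \<open>The valuation at a prime\<close>

lemma subring_type_int_poly:
  assumes "subring H (ring_of_type_algebra :: 'a::field_char_0 ring)" "x \<in> H"
  shows "poly (map_poly of_int p) x \<in> H"
proof (induction p)
  case 0
  show ?case
    using subringE(2)[OF assms(1)] by simp
next
  case (pCons a p)
  then show ?case
    using assms subring_type_of_int[OF assms(1), of a]
    by (simp add: map_poly_pCons subring_type_iff)
qed

text \<open>In a polynomial equation of \<open>x\<close>, factors X are removed until the constant
  term is nonzero. That term is then a multiple of \<open>x\<close>, with a cofactor that is a
  polynomial in \<open>x\<close> and hence lies in \<open>H\<close>.\<close>

lemma algebraic_int_dvd_nat:
  assumes H: "subring H (ring_of_type_algebra :: 'a::field_char_0 ring)"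
    and x: "x \<in> H" "x \<noteq> 0" "algebraic_int x"
  obtains N :: nat and z where "N > 0" "z \<in> H" "x * z = of_nat N"
proof -
  have "\<exists>a z. (a::int) \<noteq> 0 \<and> z \<in> H \<and> x * z = of_int a"
    if "p \<noteq> 0" "poly (map_poly of_int p) x = 0" for p :: "int poly"
    using that
  proof (induction p)
    case (pCons a p)
    show ?case
    proof (cases "a = 0")
      case True
      then show ?thesis
        using pCons x(2) by (auto simp: map_poly_pCons)
    next
      case False
      have "of_int a + x * poly (map_poly of_int p) x = 0"
        using pCons.prems by (simp add: map_poly_pCons)
      then have "x * poly (map_poly of_int p) x = of_int (- a)"
        by (simp add: eq_neg_iff_add_eq_0 add.commute)
      then show ?thesis
        using False subring_type_int_poly[OF H x(1), of p]
        by (metis neg_equal_0_iff_equal)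
    qed
  qed simp
  moreover obtain p where "poly (map_poly of_int p) x = 0" "Polynomial.lead_coeff p = 1"
    using x(3) unfolding algebraic_int_altdef_ipoly by blast
  moreover from this have "p \<noteq> 0"
    by auto
  ultimately obtain a :: int and z where a: "a \<noteq> 0" "z \<in> H" "x * z = of_int a"
    by blast
  show ?thesis
  proof (cases "a > 0")
    case True
    then show ?thesis
      using a that[of "nat a" z] by simp
  next
    case False
    then have "x * (- z) = of_nat (nat (- a))" "nat (- a) > 0"
      using a by auto
    moreover have "- z \<in> H"
      using a(2) H by (simp add: subring_type_iff)
    ultimately show ?thesis
      using that by blast
  qed
qed

locale number_field_prime =
  fixes K :: "'a::{alg_closed_field,field_char_0} set" and P :: "'a set"
  assumes K: "number_field K" and P: "P \<in> nonzero_primes K"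
begin

abbreviation R :: "'a set" where "R \<equiv> carrier (ring_of_integers K)"

lemma R: "subring R ring_of_type_algebra"
  by (rule ring_of_integers_subring[OF K])

lemma R_1: "1 \<in> R" and R_0: "0 \<in> R"
  and R_add: "a \<in> R \<Longrightarrow> b \<in> R \<Longrightarrow> a + b \<in> R"
  and R_mult: "a \<in> R \<Longrightarrow> b \<in> R \<Longrightarrow> a * b \<in> R"
  and R_uminus: "a \<in> R \<Longrightarrow> - a \<in> R"
  and R_diff: "a \<in> R \<Longrightarrow> b \<in> R \<Longrightarrow> a - b \<in> R"
  and R_of_int: "of_int i \<in> R"
  and R_of_nat: "of_nat n \<in> R"
  and R_power: "a \<in> R \<Longrightarrow> a ^ n \<in> R"
  using R subringE(2)[OF R] subring_type_diff[OF R] subring_type_of_int[OF R]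
    subring_type_of_nat[OF R] subring_type_power[OF R]
  unfolding subring_type_iff ring_of_type_algebra_simps by blast+

lemma R_sub_K: "R \<subseteq> K"
  by auto

lemma primeideal_P: "primeideal P (ring_of_integers K)"
  using P by (simp add: nonzero_primes_def)

lemma ideal_P: "ideal P (ring_of_integers K)"
  using primeideal_P by (simp add: primeideal_def)

lemma P_sub_R: "P \<subseteq> R"
  using ideal.Icarr[OF ideal_P] by blast

lemma P_add: "a \<in> P \<Longrightarrow> b \<in> P \<Longrightarrow> a + b \<in> P"
  using additive_subgroup.a_closed[OF ideal.axioms(1)[OF ideal_P], of a b] by simp

lemma P_mult: "r \<in> R \<Longrightarrow> a \<in> P \<Longrightarrow> r * a \<in> P"
  using ideal.I_l_closed[OF ideal_P, of a r] by simp

lemma P_diff: "a \<in> P \<Longrightarrow> b \<in> P \<Longrightarrow> a - b \<in> P"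
  using P_add[of a "- b"] P_mult[of "-1" b] R_uminus[OF R_1] by simp

lemma P_prime: "a \<in> R \<Longrightarrow> b \<in> R \<Longrightarrow> a * b \<in> P \<Longrightarrow> a \<in> P \<or> b \<in> P"
  using primeideal.I_prime[OF primeideal_P, of a b] by simp

lemma P_sum: "(\<And>i. i \<in> I \<Longrightarrow> f i \<in> P) \<Longrightarrow> sum f I \<in> P"
  using additive_subgroup.zero_closed[OF ideal.axioms(1)[OF ideal_P]]
  by (induction I rule: infinite_finite_induct) (auto simp: P_add)

lemma one_notin_P: "1 \<notin> P"
proof
  assume "1 \<in> P"
  then have "P = R"
    using P_sub_R P_mult[of _ 1] by auto
  then show False
    using primeideal.I_notcarr[OF primeideal_P] by simp
qed

lemma P_power: "a \<in> R \<Longrightarrow> a ^ n \<in> P \<Longrightarrow> a \<in> P"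
  by (induction n) (use one_notin_P P_prime R_power in auto)

text \<open>A nonzero element of \<open>P\<close> divides some positive integer, which therefore
  lies in \<open>P\<close>; as \<open>P\<close> is prime, so does one of its prime factors.\<close>

lemma ex_prime_in_P: "\<exists>q. prime q \<and> of_nat q \<in> P"
proof -
  have "0 \<in> P"
    using additive_subgroup.zero_closed[OF ideal.axioms(1)[OF ideal_P]] by simp
  then obtain x where x: "x \<in> P" "x \<noteq> 0"
    using P unfolding nonzero_primes_def by blast
  then have "x \<in> R"
    using P_sub_R by blast
  then obtain N z where "N > 0" "z \<in> R" "x * z = of_nat N"
    using algebraic_int_dvd_nat[OF R _ x(2)] by auto
  then have "N > 0" "of_nat N \<in> P"
    using P_mult[of z x] x(1) by (auto simp: mult.commute)
  then show ?thesis
  proof (induction N rule: less_induct)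
    case (less N)
    show ?case
    proof (cases "N = 1")
      case True
      then show ?thesis
        using less.prems one_notin_P by simp
    next
      case False
      then obtain q where q: "prime q" "q dvd N"
        using prime_factor_nat by blast
      then obtain M where M: "N = q * M"
        by blast
      then have "M > 0" "M < N"
        using less.prems prime_gt_1_nat[OF q(1)] by auto
      moreover have "of_nat q \<in> P \<or> of_nat M \<in> P"
        using less.prems(2) P_prime[OF R_of_nat R_of_nat] by (simp add: M)
      ultimately show ?thesis
        using less.IH[of M] q(1) by blast
    qed
  qed
qed

lemma of_int_in_P_if_dvd: "of_nat q \<in> P \<Longrightarrow> int q dvd m \<Longrightarrow> of_int m \<in> P"
  using P_mult[of "of_int _" "of_nat q"] R_of_int by (auto simp: mult.commute)

lemma of_int_in_P_dvd:
  assumes "prime q" "of_nat q \<in> P" "of_int m \<in> P"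
  shows "int q dvd m"
proof (rule ccontr)
  assume "\<not> int q dvd m"
  then have "coprime (int q) m"
    using assms(1) by (simp add: prime_imp_coprime)
  then obtain u v where "u * int q + v * m = 1"
    using bezout_int[of "int q" m] by (metis coprime_imp_gcd_eq_1)
  then have "of_int u * of_nat q + of_int v * of_int m = (1 :: 'a)"
    by (metis of_int_1 of_int_add of_int_mult of_int_of_nat_eq)
  then show False
    using assms one_notin_P P_add P_mult R_of_int by metis
qed

abbreviation p :: nat where "p \<equiv> rational_prime_below P"

lemma rational_prime_below: "prime p \<and> of_nat p \<in> P"
  unfolding rational_prime_below_def
proof (rule theI')
  obtain q where q: "prime q" "of_nat q \<in> P"
    using ex_prime_in_P by blast
  show "\<exists>!q. prime q \<and> of_nat q \<in> P"
  proof (rule ex1I[of _ q])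
    fix r assume r: "prime r \<and> of_nat r \<in> P"
    then have "int q dvd int r"
      using of_int_in_P_dvd[of q "int r"] q by simp
    then show "r = q"
      using r q(1) primes_dvd_imp_eq[of q r] by simp
  qed (use q in simp)
qed

lemma p_prime: "prime p" and p_in_P: "of_nat p \<in> P"
  using rational_prime_below by auto

lemma p_unique: "prime q \<Longrightarrow> of_nat q \<in> P \<Longrightarrow> q = p"
  using of_int_in_P_dvd[of p "int q"] p_prime p_in_P by (auto dest: primes_dvd_imp_eq)

lemma p_nz: "of_nat p \<noteq> (0 :: 'a)"
  using p_prime by auto

lemma of_int_in_P_iff: "of_int m \<in> P \<longleftrightarrow> int p dvd m"
  using of_int_in_P_dvd of_int_in_P_if_dvd p_prime p_in_P by blast

text \<open>Pigeonhole among the finitely many residues modulo \<open>p\<close>. For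
  \<open>x\<close> outside \<open>P\<close> this yields an inverse modulo \<open>P\<close>; for
  \<open>x\<close> in \<open>P\<close> it yields nilpotency modulo \<open>p\<close> up to a factor
  outside \<open>P\<close>.\<close>

lemma power_congruence:
  assumes "x \<in> R"
  obtains i j z where "i < j" "z \<in> R" "x ^ i - x ^ j = of_nat p * z"
proof -
  obtain F where F: "finite F" "\<forall>x\<in>R. \<exists>f\<in>F. \<exists>z\<in>R. x = f + of_nat p * z"
    using finite_residues_mod_prime[OF K p_prime] by blast
  have "\<exists>f. f \<in> F \<and> (\<exists>z\<in>R. x ^ k = f + of_nat p * z)" for k
    using F(2) R_power[OF assms] by blast
  then obtain f where f: "\<And>k. f k \<in> F" "\<And>k. \<exists>z\<in>R. x ^ k = f k + of_nat p * z"
    by metis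
  have "\<not> inj f"
    using f(1) F(1) by (metis finite_subset image_subsetI infinite_UNIV_nat finite_imageD)
  then obtain i j where ij: "i < j" "f i = f j"
    by (metis injI linorder_neqE_nat)
  obtain z w where zw: "z \<in> R" "w \<in> R" "x ^ i = f i + of_nat p * z" "x ^ j = f j + of_nat p * w"
    using f(2) by metis
  have "x ^ i - x ^ j = of_nat p * (z - w)"
    unfolding zw ij by (simp add: algebra_simps)
  then show ?thesis
    using that ij(1) R_diff zw by blast
qed

text \<open>A finite integral domain is a field: once \<open>s ^ i\<close> is cancelled,
  \<open>s ^ Suc k\<close> is 1 modulo \<open>P\<close>, and \<open>s ^ k\<close> is the
  inverse.\<close>

lemma unit_mod_P:
  assumes "s \<in> R" "s \<notin> P"
  shows "\<exists>r\<in>R. r * s - 1 \<in> P"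
proof -
  obtain i j z where ij: "i < j" "z \<in> R" "s ^ i - s ^ j = of_nat p * z"
    using power_congruence[OF assms(1)] by blast
  obtain k where k: "j = i + Suc k"
    using ij(1) less_imp_Suc_add by auto
  have "s ^ i * (1 - s ^ Suc k) = z * of_nat p"
    using ij(3) by (simp add: k power_add algebra_simps)
  then have "s ^ i * (1 - s ^ Suc k) \<in> P"
    using P_mult[OF ij(2) p_in_P] by simp
  moreover have "s ^ i \<notin> P"
    using P_power assms by blast
  ultimately have "1 - s ^ Suc k \<in> P"
    using P_prime R_power[OF assms(1)] R_diff R_1 by blast
  then have "(-1) * (1 - s ^ Suc k) \<in> P"
    by (intro P_mult R_uminus R_1)
  then have "s ^ k * s - 1 \<in> P"
    by (simp add: mult.commute)
  then show ?thesis
    using R_power[OF assms(1)] by blast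
qed

text \<open>In the finite ring \<open>R / p R\<close> every element of \<open>P\<close> becomes nilpotent after multiplication
  with a suitable \<open>s\<close> outside \<open>P\<close>; pushing \<open>s\<close> along maximal nonzero products yields an element
  \<open>b\<close> that is nonzero modulo \<open>p\<close> and annihilates \<open>P\<close>.\<close>

lemma ex_annihilator:
  obtains b where "b \<in> R" "\<not> (\<exists>z\<in>R. b = of_nat p * z)" "\<And>x. x \<in> P \<Longrightarrow> \<exists>z\<in>R. b * x = of_nat p * z"
proof -
  define I where "I = {of_nat p * z |z. z \<in> R}"
  have I_mult: "r * x \<in> I" if rx: "r \<in> R" "x \<in> I" for r x
  proof -
    obtain z where z: "z \<in> R" "x = of_nat p * z"
      using rx(2) by (auto simp: I_def)
    have "r * x = of_nat p * (r * z)"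
      by (simp add: z(2))
    then show ?thesis
      using R_mult[OF rx(1) z(1)] unfolding I_def by blast
  qed
  have I_add: "x + y \<in> I" if xy: "x \<in> I" "y \<in> I" for x y
  proof -
    obtain z w where z: "z \<in> R" "x = of_nat p * z" "w \<in> R" "y = of_nat p * w"
      using xy by (auto simp: I_def)
    have "x + y = of_nat p * (z + w)"
      by (simp add: z distrib_left)
    then show ?thesis
      using R_add[OF z(1,3)] unfolding I_def by blast
  qed
  have I_P: "I \<subseteq> P"
    using P_mult[OF _ p_in_P] by (auto simp: I_def mult.commute)
  \<comment> \<open>The factor \<open>1 - x ^ Suc k\<close> coming from two congruent powers of
    \<open>x\<close> is 1 modulo \<open>P\<close>, hence outside \<open>P\<close>.\<close>
  have nil: "\<exists>s\<in>R - P. \<exists>i. s * x ^ i \<in> I" if x: "x \<in> P" for x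
  proof -
    have xR: "x \<in> R"
      using x P_sub_R by blast
    obtain i j z where ij: "i < j" "z \<in> R" "x ^ i - x ^ j = of_nat p * z"
      using power_congruence[OF xR] by blast
    obtain k where k: "j = i + Suc k"
      using ij(1) less_imp_Suc_add by auto
    have "(1 - x ^ Suc k) * x ^ i = of_nat p * z"
      using ij(3) by (simp add: k power_add algebra_simps)
    then have "(1 - x ^ Suc k) * x ^ i \<in> I"
      using ij(2) by (auto simp: I_def)
    moreover have "1 - x ^ Suc k \<notin> P"
    proof
      assume "1 - x ^ Suc k \<in> P"
      moreover have "x ^ Suc k \<in> P"
        using P_mult[OF R_power[OF xR] x, of k] by (simp add: mult.commute)
      ultimately have "1 \<in> P"
        using P_add by fastforce
      then show False
        using one_notin_P by blast
    qed
    ultimately show ?thesis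
      using R_diff[OF R_1 R_power[OF xR]] by blast
  qed
  obtain F where F: "finite F" "\<forall>x\<in>R. \<exists>f\<in>F. \<exists>z\<in>R. x = f + of_nat p * z"
    using finite_residues_mod_prime[OF K p_prime] by blast
  \<comment> \<open>As \<open>p\<close> lies in \<open>P\<close>, representatives of elements of
    \<open>P\<close> are again in \<open>P\<close>; so \<open>G\<close> represents all of
    \<open>P\<close> modulo \<open>p\<close>.\<close>
  define G where "G = F \<inter> P"
  have G: "finite G" "G \<subseteq> P"
    using F(1) by (auto simp: G_def)
  \<comment> \<open>The product of the factors belonging to the single elements serves all of
    \<open>G\<close>, and it stays outside \<open>P\<close> because \<open>P\<close> is
    prime.\<close>
  have "\<exists>s\<in>R - P. \<forall>x\<in>G. \<exists>i. s * x ^ i \<in> I"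
    using G
  proof (induction G rule: finite_induct)
    case empty
    then show ?case
      using R_1 one_notin_P by blast
  next
    case (insert x G)
    then obtain s where s: "s \<in> R - P" "\<forall>x\<in>G. \<exists>i. s * x ^ i \<in> I"
      by auto
    obtain s' i where s': "s' \<in> R - P" "s' * x ^ i \<in> I"
      using nil[of x] insert.prems by blast
    have "s' * s \<in> R - P"
      using s(1) s'(1) P_prime R_mult by blast
    moreover have "\<exists>i. (s' * s) * x' ^ i \<in> I" if x': "x' \<in> insert x G" for x'
    proof (cases "x' = x")
      case True
      then show ?thesis
        using I_mult[of s "s' * x ^ i"] s(1) s'(2) by (auto simp: mult_ac)
    next
      case False
      then obtain k where "s * x' ^ k \<in> I"
        using s(2) x' by blast
      then show ?thesis
        using I_mult[of s' "s * x' ^ k"] s'(1) by (auto simp: mult_ac)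
    qed
    ultimately show ?case
      by blast
  qed
  then obtain s where s: "s \<in> R - P" "\<forall>x\<in>G. \<exists>i. s * x ^ i \<in> I"
    by blast
  \<comment> \<open>The annihilated set grows one element at a time: \<open>c\<close> becomes
    \<open>c * x ^ k\<close>, where \<open>k\<close> is the last exponent before the product falls
    into \<open>I\<close>. The start is \<open>c = 1\<close>, as \<open>s\<close> is outside
    \<open>P\<close> and hence outside \<open>I\<close>.\<close>
  have "\<exists>c\<in>R. s * c \<notin> I \<and> (\<forall>x\<in>H. s * c * x \<in> I)" if "H \<subseteq> G" for H
    using finite_subset[OF that G(1)] that
  proof (induction H rule: finite_induct)
    case empty
    then show ?case
      using s(1) I_P R_1 by (intro bexI[of _ 1]) auto
  next
    case (insert x H)
    then obtain c where c: "c \<in> R" "s * c \<notin> I" "\<forall>x\<in>H. s * c * x \<in> I"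
      by auto
    have xR: "x \<in> R"
      using insert.prems G(2) P_sub_R by blast
    obtain i where "s * x ^ i \<in> I"
      using s(2) insert.prems by blast
    then have i: "s * c * x ^ i \<in> I"
      using I_mult[OF c(1), of "s * x ^ i"] by (simp add: mult_ac)
    define j where "j = (LEAST i. s * c * x ^ i \<in> I)"
    have j: "s * c * x ^ j \<in> I"
      unfolding j_def using i by (rule LeastI)
    have "j \<noteq> 0"
      using j c(2) by (metis mult.right_neutral power_0)
    then obtain k where k: "j = Suc k"
      using not0_implies_Suc by blast
    have "s * (c * x ^ k) \<notin> I"
      using not_less_Least[of k "\<lambda>i. s * c * x ^ i \<in> I"] k by (auto simp: j_def mult.assoc)
    moreover have "s * (c * x ^ k) * x' \<in> I" if "x' \<in> insert x H" for x'
    proof (cases "x' = x")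
      case True
      then show ?thesis
        using j by (simp add: k mult_ac)
    next
      case False
      then have "s * c * x' \<in> I"
        using c(3) that by blast
      then show ?thesis
        using I_mult[OF R_power[OF xR], of "s * c * x'" k] by (simp add: mult_ac)
    qed
    ultimately show ?case
      using R_mult[OF c(1) R_power[OF xR]] by blast
  qed
  from this[of G] obtain c where c: "c \<in> R" "s * c \<notin> I" "\<And>x. x \<in> G \<Longrightarrow> s * c * x \<in> I"
    by blast
  show ?thesis
  proof (rule that[of "s * c"])
    show "s * c \<in> R"
      using s(1) c(1) R_mult by blast
    show "\<not> (\<exists>z\<in>R. s * c = of_nat p * z)"
      using c(2) by (auto simp: I_def)
    fix x assume x: "x \<in> P"
    then obtain f z where f: "f \<in> F" "z \<in> R" "x = f + of_nat p * z"
      using F(2) P_sub_R by blast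
    have "x - z * of_nat p \<in> P"
      by (intro P_diff x P_mult f(2) p_in_P)
    then have "f \<in> G"
      using f by (simp add: G_def mult.commute)
    moreover have "of_nat p * z \<in> I"
      using f(2) by (auto simp: I_def)
    ultimately have "s * c * f + s * c * (of_nat p * z) \<in> I"
      using I_add I_mult c(3) \<open>s * c \<in> R\<close> by blast
    then show "\<exists>z\<in>R. s * c * x = of_nat p * z"
      by (auto simp: I_def f(3) distrib_left)
  qed
qed

text \<open>If \<open>y * t \<in> P\<close> held for all \<open>t \<in> P\<close>, then all \<open>p * y ^ k\<close>, and hence \<open>y\<close>, would be integral.\<close>

lemma ex_inverse_uniformizer:
  obtains y t where "y \<in> K" "y \<notin> R" "\<And>x. x \<in> P \<Longrightarrow> y * x \<in> R" "t \<in> P" "y * t \<notin> P"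
proof -
  obtain b where b: "b \<in> R" "\<not> (\<exists>z\<in>R. b = of_nat p * z)" "\<And>x. x \<in> P \<Longrightarrow> \<exists>z\<in>R. b * x = of_nat p * z"
    using ex_annihilator by blast
  \<comment> \<open>\<open>y\<close> lies in the inverse ideal of \<open>P\<close> because
    \<open>b\<close> annihilates \<open>P\<close> modulo \<open>p\<close>; it is not integral
    because \<open>b\<close> is no multiple of \<open>p\<close>.\<close>
  define y where "y = b / of_nat p"
  have b_eq: "b = of_nat p * y"
    using p_nz by (simp add: y_def)
  have yK: "y \<in> K"
    unfolding y_def using R_sub_K by (intro number_field_divide[OF K]) (use b(1) R_of_nat in auto)
  have yR: "y \<notin> R"
    using b(2) b_eq by blast
  have yP: "y * x \<in> R" if "x \<in> P" for x
    using b(3)[OF that] p_nz by (auto simp: b_eq mult.assoc)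
  have "\<exists>t\<in>P. y * t \<notin> P"
  proof (rule ccontr)
    assume "\<not> ?thesis"
    then have st: "y * t \<in> P" if "t \<in> P" for t
      using that by blast
    have "of_nat p * y ^ k \<in> P" for k
      by (induction k) (use st p_in_P in \<open>auto simp: mult.left_commute\<close>)
    then have "algebraic_int (of_nat p * y ^ k)" for k
      using P_sub_R by (metis mem_ring_of_integers subsetD)
    from ring_of_integers_completely_closed[OF K prime_gt_0_nat[OF p_prime] yK this]
    have "algebraic_int y" .
    then show False
      using yR yK by simp
  qed
  then show ?thesis
    using that yK yR yP by blast
qed

section \<open>Powers of \<open>P\<close> and additivity of the order\<close>

definition PP :: "nat \<Rightarrow> 'a set" where
  "PP n = P [^]\<^bsub>ideals_set (ring_of_integers K)\<^esub> n"

lemma PP_0: "PP 0 = R"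
  by (simp add: PP_def nat_pow_def ideals_set_def)

lemma PP_Suc: "PP (Suc n) = ideal_prod (ring_of_integers K) (PP n) P"
  by (simp add: PP_def nat_pow_def ideals_set_def)

lemma ideal_PP: "ideal (PP n) (ring_of_integers K)"
proof -
  interpret O: cring "ring_of_integers K"
    by (rule ring_of_integers_cring[OF K])
  show ?thesis
    by (induction n) (simp_all only: PP_0 PP_Suc O.oneideal O.ideal_prod_is_ideal ideal_P)
qed

lemma PP_add: "a \<in> PP n \<Longrightarrow> b \<in> PP n \<Longrightarrow> a + b \<in> PP n"
  using additive_subgroup.a_closed[OF ideal.axioms(1)[OF ideal_PP], of a n b] by simp

lemma PP_mult: "r \<in> R \<Longrightarrow> a \<in> PP n \<Longrightarrow> r * a \<in> PP n"
  using ideal.I_l_closed[OF ideal_PP, of a n r] by simp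

lemma PP_sub_R: "PP n \<subseteq> R"
  using ideal.Icarr[OF ideal_PP] by blast

lemma PP_SucI: "a \<in> PP n \<Longrightarrow> b \<in> P \<Longrightarrow> a * b \<in> PP (Suc n)"
  using ideal_prod.prod[of a "PP n" b P "ring_of_integers K"] by (simp add: PP_Suc)

lemma PP_powerI: "t \<in> P \<Longrightarrow> t ^ n \<in> PP n"
proof (induction n)
  case 0
  then show ?case
    using R_1 by (simp add: PP_0)
next
  case (Suc n)
  then show ?case
    using PP_SucI[of "t ^ n" n t] by (simp add: mult.commute)
qed

text \<open>If \<open>r\<close> and \<open>u\<close> invert \<open>s\<close> modulo the
  \<open>n\<close>-th power and modulo \<open>P\<close>, the product of the two errors lies in the
  next power and equals \<open>1 - (r + u - r * u * s) * s\<close>.\<close>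

lemma unit_mod_PP:
  assumes "s \<in> R" "s \<notin> P"
  shows "\<exists>r\<in>R. r * s - 1 \<in> PP n"
proof (induction n)
  case 0
  have "1 * s - 1 \<in> R"
    using assms(1) R_1 R_diff R_mult by blast
  then show ?case
    using R_1 unfolding PP_0 by blast
next
  case (Suc n)
  then obtain r where r: "r \<in> R" "r * s - 1 \<in> PP n"
    by blast
  obtain u where u: "u \<in> R" "u * s - 1 \<in> P"
    using unit_mod_P[OF assms] by blast
  have "(-1) * ((r * s - 1) * (u * s - 1)) \<in> PP (Suc n)"
    by (intro PP_mult PP_SucI r u R_uminus R_1)
  moreover have "(-1) * ((r * s - 1) * (u * s - 1)) = (r + u - r * u * s) * s - 1"
    by (simp add: algebra_simps)
  moreover have "r + u - r * u * s \<in> R"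
    by (intro R_diff R_add R_mult r u assms)
  ultimately show ?case
    by metis
qed

text \<open>Each factor from \<open>P\<close> absorbs one \<open>y\<close>. Conversely
  \<open>s = (y * t) ^ n\<close> is outside \<open>P\<close> and so invertible modulo
  \<open>PP n\<close>, while \<open>s * x = (y ^ n * x) * t ^ n\<close> lies in \<open>PP n\<close>.
  Membership in an ideal power thus becomes an integrality condition, which behaves well under
  products.\<close>

lemma PP_iff:
  assumes y: "\<And>x. x \<in> P \<Longrightarrow> y * x \<in> R" and t: "t \<in> P" "y * t \<notin> P"
  shows "x \<in> PP n \<longleftrightarrow> x \<in> R \<and> y ^ n * x \<in> R"
proof
  assume "x \<in> PP n"
  moreover have "y ^ n * x \<in> R" if "x \<in> PP n" for x
    using that
  proof (induction n arbitrary: x)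
    case 0
    then show ?case
      by (simp add: PP_0)
  next
    case (Suc n)
    from Suc.prems show ?case
      unfolding PP_Suc
    proof (induction rule: ideal_prod.induct)
      case (prod i j)
      have "(y ^ n * i) * (y * j) \<in> R"
        by (intro R_mult Suc.IH y prod)
      then show ?case
        by (simp only: ring_of_integers_simps) (simp add: mult_ac)
    next
      case (sum a b)
      then show ?case
        using R_add[of "y ^ Suc n * a" "y ^ Suc n * b"]
        by (simp only: ring_of_integers_simps distrib_left)
    qed
  qed
  ultimately show "x \<in> R \<and> y ^ n * x \<in> R"
    using PP_sub_R by blast
next
  assume x: "x \<in> R \<and> y ^ n * x \<in> R"
  define s where "s = (y * t) ^ n"
  have s: "s \<in> R" "s \<notin> P"
    unfolding s_def using R_power[OF y[OF t(1)]] P_power[OF y[OF t(1)]] t(2) by blast+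
  obtain r where r: "r \<in> R" "r * s - 1 \<in> PP n"
    using unit_mod_PP[OF s] by blast
  have "(y ^ n * x) * t ^ n \<in> PP n"
    using x by (intro PP_mult PP_powerI t) blast
  then have "s * x \<in> PP n"
    by (simp add: s_def power_mult_distrib mult_ac)
  then have "r * (s * x) + (- x) * (r * s - 1) \<in> PP n"
    using x PP_mult[OF r(1)] PP_mult[OF R_uminus r(2)] by (intro PP_add) blast+
  then show "x \<in> PP n"
    by (simp add: algebra_simps)
qed

lemma PP_antimono:
  assumes "m \<le> n"
  shows "PP n \<subseteq> PP m"
  using assms
proof (induction rule: dec_induct)
  case (step k)
  have "PP (Suc k) \<subseteq> PP k"
    unfolding PP_Suc using ring.ideal_prod_inter[OF _ ideal_PP ideal_P]
      cring.axioms(1)[OF ring_of_integers_cring[OF K]] by blast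
  with step show ?case
    by blast
qed simp

lemma PP_Suc_0_sub_P: "PP (Suc 0) \<subseteq> P"
  unfolding PP_Suc using ring.ideal_prod_inter[OF _ ideal_PP ideal_P]
    cring.axioms(1)[OF ring_of_integers_cring[OF K]] by blast

lemma ord_integer_eqI:
  assumes "x \<in> PP n" "x \<notin> PP (Suc n)"
  shows "ord_integer K P x = n"
  unfolding ord_integer_def PP_def[symmetric]
proof (rule Greatest_equality)
  fix m assume "x \<in> PP m"
  then show "m \<le> n"
    using assms(2) PP_antimono[of "Suc n" m] by (meson not_less_eq_eq subsetD)
qed (use assms in simp)

text \<open>\<open>GREATEST\<close> is meaningful only if some power misses \<open>x\<close>.
  Otherwise all \<open>y ^ n * x\<close> are integral; multiplied by a \<open>z\<close> with
  \<open>x * z = N\<close> they make all \<open>N * y ^ n\<close> integral, which forces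
  \<open>y\<close> to be integral.\<close>

lemma ord_integer:
  assumes x: "x \<in> R" "x \<noteq> 0"
  shows "x \<in> PP (ord_integer K P x)" "x \<notin> PP (Suc (ord_integer K P x))"
proof -
  obtain y t where y: "y \<in> K" "y \<notin> R" "\<And>x. x \<in> P \<Longrightarrow> y * x \<in> R" "t \<in> P" "y * t \<notin> P"
    using ex_inverse_uniformizer by blast
  note PP_iff = PP_iff[of y, OF y(3-5)]
  obtain N z where N: "N > 0" "z \<in> R" "x * z = of_nat N"
    using algebraic_int_dvd_nat[OF R x] x(1) by auto
  have "\<exists>n. x \<notin> PP n"
  proof (rule ccontr)
    assume "\<not> ?thesis"
    then have "y ^ n * x \<in> R" for n
      using PP_iff by blast
    then have "(y ^ n * x) * z \<in> R" for n
      using N(2) R_mult by blast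
    then have "algebraic_int (of_nat N * y ^ n)" for n
      by (simp flip: N(3) add: mult_ac)
    then have "algebraic_int y"
      using ring_of_integers_completely_closed[OF K N(1) y(1)] by blast
    then show False
      using y(1,2) by simp
  qed
  define n where "n = (LEAST n. x \<notin> PP n)"
  have n: "x \<notin> PP n"
    unfolding n_def using \<open>\<exists>n. x \<notin> PP n\<close> by (rule LeastI_ex)
  have "n \<noteq> 0"
    using n x(1) by (metis PP_0)
  then obtain k where k: "n = Suc k"
    using not0_implies_Suc by blast
  have "x \<in> PP k"
    using not_less_Least[of k "\<lambda>n. x \<notin> PP n"] k by (auto simp: n_def)
  moreover from this have "ord_integer K P x = k"
    using n by (intro ord_integer_eqI) (simp_all add: k)
  ultimately show "x \<in> PP (ord_integer K P x)" "x \<notin> PP (Suc (ord_integer K P x))"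
    using n by (simp_all add: k)
qed

text \<open>With \<open>m\<close> and \<open>n\<close> the two orders, \<open>y ^ m * x\<close> and
  \<open>y ^ n * w\<close> are integers outside \<open>P\<close>, since \<open>y\<close> times an
  element of \<open>P\<close> is integral. Their product is outside \<open>P\<close> as well, so it
  admits no further factor \<open>y\<close>.\<close>

lemma ord_integer_mult:
  assumes "x \<in> R" "x \<noteq> 0" "w \<in> R" "w \<noteq> 0"
  shows "ord_integer K P (x * w) = ord_integer K P x + ord_integer K P w"
proof (rule ord_integer_eqI)
  obtain y t where y: "y \<in> K" "y \<notin> R" "\<And>x. x \<in> P \<Longrightarrow> y * x \<in> R" "t \<in> P" "y * t \<notin> P"
    using ex_inverse_uniformizer by blast
  note PP_iff = PP_iff[of y, OF y(3-5)]
  define m n where "m = ord_integer K P x" and "n = ord_integer K P w"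
  have m: "y ^ m * x \<in> R" "y * (y ^ m * x) \<notin> R"
    using ord_integer[OF assms(1,2)] assms(1) PP_iff[of x m] PP_iff[of x "Suc m"]
    by (simp_all only: m_def power_Suc mult.assoc simp_thms)
  have n: "y ^ n * w \<in> R" "y * (y ^ n * w) \<notin> R"
    using ord_integer[OF assms(3,4)] assms(3) PP_iff[of w n] PP_iff[of w "Suc n"]
    by (simp_all only: n_def power_Suc mult.assoc simp_thms)
  have xw: "x * w \<in> R"
    using assms R_mult by blast
  have prod: "(y ^ m * x) * (y ^ n * w) = y ^ (m + n) * (x * w)"
    by (simp add: power_add mult_ac)
  show "x * w \<in> PP (m + n)"
    using PP_iff[of "x * w" "m + n"] R_mult[OF m(1) n(1)] xw by (simp only: prod simp_thms)
  have notP: "y ^ (m + n) * (x * w) \<notin> P"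
    using P_prime[OF m(1) n(1)] m(2) n(2) y(3) unfolding prod by blast
  show "x * w \<notin> PP (Suc (m + n))"
  proof
    assume "x * w \<in> PP (Suc (m + n))"
    then have "y * (y ^ (m + n) * (x * w)) \<in> R"
      using PP_iff[of "x * w" "Suc (m + n)"] by (simp only: power_Suc mult.assoc simp_thms)
    then have "y ^ (m + n) * (x * w) \<in> PP (Suc 0)"
      using PP_iff[of "y ^ (m + n) * (x * w)" "Suc 0"] R_mult[OF m(1) n(1)]
      by (simp only: prod power_Suc power_0 mult_1_right simp_thms)
    then show False
      using notP PP_Suc_0_sub_P by blast
  qed
qed

lemma ord_integer_unit: "x \<in> R \<Longrightarrow> x \<notin> P \<Longrightarrow> ord_integer K P x = 0"
proof (rule ord_integer_eqI)
  assume x: "x \<in> R" "x \<notin> P"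
  then show "x \<in> PP 0"
    unfolding PP_0 by simp
  show "x \<notin> PP (Suc 0)"
    using x(2) PP_Suc_0_sub_P by blast
qed

lemma ord_integer_p_pos: "ord_integer K P (of_nat p) > 0"
proof -
  have "1 * of_nat p \<in> PP (Suc 0)"
    by (intro PP_SucI p_in_P) (use R_1 in \<open>simp only: PP_0\<close>)
  then have "of_nat p \<in> PP (Suc 0)"
    by simp
  then show ?thesis
    using ord_integer(2)[OF R_of_nat p_nz] by (metis neq0_conv)
qed

text \<open>Cross-multiplication and additivity make the difference independent of the fraction, as
  the \<open>THE\<close> in the definition requires.\<close>

lemma prime_ord_divide:
  assumes "a \<in> R" "a \<noteq> 0" "b \<in> R" "b \<noteq> 0"
  shows "prime_ord K P (a / b) = int (ord_integer K P a) - int (ord_integer K P b)"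
  unfolding prime_ord_def
proof (rule the_equality)
  fix n
  assume "\<exists>a'\<in>R. \<exists>b'\<in>R. a' \<noteq> 0 \<and> b' \<noteq> 0 \<and> a / b = a' / b' \<and>
      n = int (ord_integer K P a') - int (ord_integer K P b')"
  then obtain a' b' where ab: "a' \<in> R" "b' \<in> R" "a' \<noteq> 0" "b' \<noteq> 0" "a / b = a' / b'"
      "n = int (ord_integer K P a') - int (ord_integer K P b')"
    by blast
  have "a * b' = a' * b"
    using ab assms by (simp add: field_simps)
  then have "ord_integer K P a + ord_integer K P b' = ord_integer K P a' + ord_integer K P b"
    using ord_integer_mult[of a b'] ord_integer_mult[of a' b] ab assms by metis
  then show "n = int (ord_integer K P a) - int (ord_integer K P b)"
    using ab(6) by linarith
qed (use assms in blast)

lemma ord_integer_of_int: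
  assumes "m \<noteq> 0"
  shows "ord_integer K P (of_int m) = multiplicity (int p) m * ord_integer K P (of_nat p)"
proof -
  have pow: "ord_integer K P (of_nat p ^ k) = k * ord_integer K P (of_nat p)" for k
  proof (induction k)
    case 0
    show ?case
      using ord_integer_unit[OF R_1 one_notin_P] by simp
  next
    case (Suc k)
    then show ?case
      using ord_integer_mult[OF R_of_nat p_nz R_power[OF R_of_nat], of p k] p_nz by simp
  qed
  define k where "k = multiplicity (int p) m"
  obtain m' where m': "m = int p ^ k * m'" "\<not> int p dvd m'"
    using multiplicity_decompose'[of m "int p"] assms p_prime not_prime_unit[of "int p"]
    by (metis k_def prime_nat_int_transfer)
  have "of_int m = of_nat p ^ k * (of_int m' :: 'a)"
    by (simp add: m'(1))
  moreover have "m' \<noteq> 0"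
    using m'(2) by auto
  moreover have "ord_integer K P (of_int m') = 0"
    using ord_integer_unit[OF R_of_int] of_int_in_P_iff m'(2) by blast
  ultimately show ?thesis
    using ord_integer_mult[OF R_power[OF R_of_nat] _ R_of_int, of p k m'] p_nz
    by (simp add: pow k_def)
qed

text \<open>The ramification index \<open>e\<close> cancels, so all primes over one rational prime
  agree on the rationals.\<close>

lemma prime_val_of_int_divide:
  assumes "a \<noteq> 0" "b \<noteq> 0"
  shows "prime_val K P (of_int a / of_int b) =
    of_nat (multiplicity (int p) a) - of_nat (multiplicity (int p) b)"
proof -
  define e where "e = ord_integer K P (of_nat p)"
  have e: "e > 0"
    unfolding e_def by (rule ord_integer_p_pos)
  have "prime_ord K P (of_nat p / 1) = int e - 0"
    using prime_ord_divide[OF R_of_nat p_nz R_1] ord_integer_unit[OF R_1 one_notin_P] by (simp add: e_def)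
  then have 1: "prime_ord K P (of_nat p) = int e"
    by simp
  have 2: "prime_ord K P (of_int a / of_int b) =
      int (multiplicity (int p) a * e) - int (multiplicity (int p) b * e)"
    using prime_ord_divide[OF R_of_int _ R_of_int, of a b] assms
    by (simp add: ord_integer_of_int e_def)
  show ?thesis
    unfolding prime_val_def 1 2 using e by (simp add: field_simps)
qed

end

section \<open>Primes above a given prime\<close>

text \<open>Nonzero primes are maximal: an element of \<open>Q\<close> outside \<open>P\<close> is
  invertible modulo \<open>P\<close>, which would put 1 into \<open>Q\<close>.\<close>

lemma nonzero_primes_subset_imp_eq:
  assumes K: "number_field K" and P: "P \<in> nonzero_primes K" "Q \<in> nonzero_primes K" and sub: "P \<subseteq> Q"
  shows "P = Q"
proof -
  interpret P: number_field_prime K P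
    by unfold_locales (use K P in auto)
  interpret Q: number_field_prime K Q
    by unfold_locales (use K P in auto)
  have "s \<in> P" if s: "s \<in> Q" for s
  proof (rule ccontr)
    assume "s \<notin> P"
    then obtain r where r: "r \<in> P.R" "r * s - 1 \<in> P"
      using P.unit_mod_P[of s] s Q.P_sub_R by blast
    then have "r * s - (r * s - 1) \<in> Q"
      using Q.P_diff[OF Q.P_mult[OF _ s], of r "r * s - 1"] sub by blast
    then show False
      using Q.one_notin_P by simp
  qed
  with sub show ?thesis
    by blast
qed

text \<open>By maximality each member of \<open>S\<close> has an element outside \<open>Q\<close>;
  the product of these elements is outside \<open>Q\<close> because \<open>Q\<close> is
  prime.\<close>

lemma nonzero_primes_avoidance:
  assumes K: "number_field K" and Q: "Q \<in> nonzero_primes K"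
    and S: "finite S" "S \<subseteq> nonzero_primes K" "Q \<notin> S"
  shows "\<exists>x. x \<in> carrier (ring_of_integers K) \<and> x \<notin> Q \<and> (\<forall>Q'\<in>S. x \<in> Q')"
  using S
proof (induction S rule: finite_induct)
  case empty
  interpret Q: number_field_prime K Q
    by unfold_locales (use K Q in auto)
  show ?case
    using Q.one_notin_P Q.R_1 by blast
next
  case (insert P S)
  interpret Q: number_field_prime K Q
    by unfold_locales (use K Q in auto)
  interpret P: number_field_prime K P
    by unfold_locales (use K insert.prems in auto)
  obtain x where x: "x \<in> Q.R" "x \<notin> Q" "\<forall>Q'\<in>S. x \<in> Q'"
    using insert by blast
  have "\<not> P \<subseteq> Q"
    using nonzero_primes_subset_imp_eq[OF K P.P Q] insert.prems by blast
  then obtain y where y: "y \<in> P" "y \<notin> Q"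
    by blast
  then have "y \<in> Q.R"
    using P.P_sub_R by blast
  then have "x * y \<in> Q.R" "x * y \<notin> Q"
    using x y Q.P_prime Q.R_mult by blast+
  moreover have "x * y \<in> P"
    using P.P_mult x y by blast
  moreover have "x * y \<in> Q'" if "Q' \<in> S" for Q'
  proof -
    interpret Q': number_field_prime K Q'
      by unfold_locales (use K insert.prems that in auto)
    show ?thesis
      using Q'.P_mult[of y x] x(3) that \<open>y \<in> Q.R\<close> by (simp add: mult.commute)
  qed
  ultimately show ?case
    by blast
qed

text \<open>With more than \<open>n\<close> primes over \<open>q\<close>, take for each an integer
  outside it that lies in all the others. In a relation between these integers with
  \<open>c k\<close> prime to \<open>q\<close>, only the \<open>k\<close>-th term survives modulo
  \<open>e k\<close>; so \<open>c k\<close> lies in \<open>e k\<close> and is divisible by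
  \<open>q\<close> after all.\<close>

lemma finite_primes_over:
  assumes K: "number_field K" and q: "prime q"
  shows "finite {Q \<in> nonzero_primes K. of_nat q \<in> Q}"
proof -
  obtain n :: nat where n: "\<And>m x q. m > n \<Longrightarrow> (\<And>i. i < m \<Longrightarrow> x i \<in> K) \<Longrightarrow> prime q \<Longrightarrow>
       \<exists>c::nat \<Rightarrow> int. (\<exists>i<m. \<not> int q dvd c i) \<and> (\<Sum>i<m. of_int (c i) * x i) = 0"
    using number_field_dependent_mod_prime[OF K] by blast
  have "card S \<le> n" if S: "finite S" "S \<subseteq> {Q \<in> nonzero_primes K. of_nat q \<in> Q}" for S
  proof (rule ccontr)
    assume "\<not> card S \<le> n"
    then have m: "card S > n"
      by simp
    obtain e where e: "bij_betw e {..<card S} S"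
      using ex_bij_betw_nat_finite[OF S(1)] by (auto simp: atLeast0LessThan)
    have eS: "e i \<in> S" if "i < card S" for i
      using e that by (auto simp: bij_betw_def)
    have "\<exists>x. i < card S \<longrightarrow> x \<in> carrier (ring_of_integers K) \<and> x \<notin> e i \<and> (\<forall>Q'\<in>S - {e i}. x \<in> Q')" for i
      using nonzero_primes_avoidance[OF K, of "e i" "S - {e i}"] S eS by blast
    then obtain x where x: "\<And>i. i < card S \<Longrightarrow>
        x i \<in> carrier (ring_of_integers K) \<and> x i \<notin> e i \<and> (\<forall>Q'\<in>S - {e i}. x i \<in> Q')"
      by metis
    have "x i \<in> K" if "i < card S" for i
      using x[OF that] by simp
    from n[of "card S" x q, OF m this q] obtain c :: "nat \<Rightarrow> int" where
      c: "(\<exists>i<card S. \<not> int q dvd c i) \<and> (\<Sum>i<card S. of_int (c i) * x i) = 0" ..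
    then obtain k where k: "k < card S" "\<not> int q dvd c k"
      by blast
    interpret Q: number_field_prime K "e k"
      by unfold_locales (use K eS[OF k(1)] S in auto)
    have "(\<Sum>i<card S. of_int (c i) * x i) =
        of_int (c k) * x k + (\<Sum>i\<in>{..<card S} - {k}. of_int (c i) * x i)"
      using k(1) by (subst sum.remove[of _ k]) auto
    then have "of_int (c k) * x k = 0 - (\<Sum>i\<in>{..<card S} - {k}. of_int (c i) * x i)"
      using c by (simp add: eq_neg_iff_add_eq_0)
    also have "\<dots> \<in> e k"
    proof (rule Q.P_diff)
      show "0 \<in> e k"
        using Q.of_int_in_P_iff[of 0] by simp
      have "of_int (c i) * x i \<in> e k" if "i \<in> {..<card S} - {k}" for i
      proof (rule Q.P_mult)
        have "e k \<noteq> e i"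
          using e k(1) that by (auto simp: bij_betw_def inj_on_def)
        then show "x i \<in> e k"
          using x[of i] that eS[OF k(1)] by blast
      qed (rule Q.R_of_int)
      then show "(\<Sum>i\<in>{..<card S} - {k}. of_int (c i) * x i) \<in> e k"
        by (rule Q.P_sum)
    qed
    finally have "of_int (c k) \<in> e k"
      using Q.P_prime[OF Q.R_of_int, of "x k" "c k"] x[OF k(1)] by blast
    moreover have "q = Q.p"
      using Q.p_unique[OF q] S(2) eS[OF k(1)] by blast
    ultimately show False
      using Q.of_int_in_P_iff k(2) by blast
  qed
  then show ?thesis
    using finite_if_finite_subsets_card_bdd[of "{Q \<in> nonzero_primes K. of_nat q \<in> Q}" n] by blast
qed

section \<open>Prime ideals of a larger field\<close>

lemma ideal_ring_of_integersI:
  assumes K: "number_field K" and "I \<subseteq> carrier (ring_of_integers K)" "0 \<in> I"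
    and "\<And>a b. a \<in> I \<Longrightarrow> b \<in> I \<Longrightarrow> a + b \<in> I"
    and mult: "\<And>r a. r \<in> carrier (ring_of_integers K) \<Longrightarrow> a \<in> I \<Longrightarrow> r * a \<in> I"
  shows "ideal I (ring_of_integers K)"
proof -
  interpret O: cring "ring_of_integers K"
    by (rule ring_of_integers_cring[OF K])
  have R: "subring (carrier (ring_of_integers K)) ring_of_type_algebra"
    by (rule ring_of_integers_subring[OF K])
  have inv: "\<ominus>\<^bsub>ring_of_integers K\<^esub> x = - x" if "x \<in> carrier (ring_of_integers K)" for x
    using O.minus_equality[of "- x" x] that R unfolding subring_type_iff by simp
  have neg: "- a \<in> I" if "a \<in> I" for a
    using mult[of "-1" a] that R unfolding subring_type_iff by simp
  show ?thesis
  proof (rule idealI)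
    show "ring (ring_of_integers K)"
      by (rule O.ring_axioms)
    show "subgroup I (add_monoid (ring_of_integers K))"
    proof (rule O.add.subgroupI)
      fix a assume "a \<in> I"
      then show "\<ominus>\<^bsub>ring_of_integers K\<^esub> a \<in> I"
        using inv neg assms(2) by (metis subsetD)
    qed (use assms in auto)
    fix a x assume ax: "a \<in> I" "x \<in> carrier (ring_of_integers K)"
    then have "x * a \<in> I"
      by (intro mult)
    then show "x \<otimes>\<^bsub>ring_of_integers K\<^esub> a \<in> I" "a \<otimes>\<^bsub>ring_of_integers K\<^esub> x \<in> I"
      by (simp_all add: mult.commute)
  qed
qed

text \<open>Zorn's lemma yields an ideal maximal among those that contain \<open>I\<close> and avoid
  1, and maximality makes it prime. Ideals are described by closure conditions on plain sets, which
  pass directly to unions of chains.\<close>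

lemma prime_ideal_containing:
  assumes K: "number_field K"
    and I: "I \<subseteq> carrier (ring_of_integers K)" "0 \<in> I" "\<And>a b. a \<in> I \<Longrightarrow> b \<in> I \<Longrightarrow> a + b \<in> I"
      "\<And>r a. r \<in> carrier (ring_of_integers K) \<Longrightarrow> a \<in> I \<Longrightarrow> r * a \<in> I" "1 \<notin> I"
  obtains Q where "primeideal Q (ring_of_integers K)" "I \<subseteq> Q"
proof -
  define R where "R = carrier (ring_of_integers K)"
  define idl where "idl = (\<lambda>I. I \<subseteq> R \<and> 0 \<in> I \<and> (\<forall>a\<in>I. \<forall>b\<in>I. a + b \<in> I) \<and> (\<forall>r\<in>R. \<forall>a\<in>I. r * a \<in> I))"
  have "idl I"
    using I unfolding idl_def R_def by blast
  have R: "subring R ring_of_type_algebra"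
    unfolding R_def by (rule ring_of_integers_subring[OF K])
  note R' = R[unfolded subring_type_iff]
  define \<A> where "\<A> = {J. idl J \<and> I \<subseteq> J \<and> 1 \<notin> J}"
  have "\<Union>\<C> \<in> \<A>" if \<C>: "\<C> \<noteq> {}" "subset.chain \<A> \<C>" for \<C>
  proof -
    have mem: "idl J \<and> I \<subseteq> J \<and> 1 \<notin> J" if "J \<in> \<C>" for J
      using \<C>(2) that by (auto simp: subset.chain_def \<A>_def)
    have "a + b \<in> \<Union>\<C>" if ab: "a \<in> \<Union>\<C>" "b \<in> \<Union>\<C>" for a b
    proof -
      obtain J J' where J: "J \<in> \<C>" "a \<in> J" "J' \<in> \<C>" "b \<in> J'"
        using ab by blast
      then have "J \<subseteq> J' \<or> J' \<subseteq> J"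
        using \<C>(2) by (metis subset_chain_def)
      then show ?thesis
        using J mem[of J] mem[of J'] unfolding idl_def by blast
    qed
    moreover have "\<Union>\<C> \<subseteq> R"
      using mem unfolding idl_def by blast
    moreover obtain J where "J \<in> \<C>"
      using \<C>(1) by blast
    then have "0 \<in> \<Union>\<C>" "I \<subseteq> \<Union>\<C>"
      using mem[of J] unfolding idl_def by blast+
    moreover have "r * a \<in> \<Union>\<C>" if "r \<in> R" "a \<in> \<Union>\<C>" for r a
      using that mem unfolding idl_def by blast
    moreover have "1 \<notin> \<Union>\<C>"
      using mem by blast
    ultimately show ?thesis
      unfolding \<A>_def idl_def by blast
  qed
  moreover have "\<A> \<noteq> {}"
    using I(5) \<open>idl I\<close> by (auto simp: \<A>_def)
  ultimately obtain Q where Q: "Q \<in> \<A>" "\<And>J. J \<in> \<A> \<Longrightarrow> Q \<subseteq> J \<Longrightarrow> J = Q"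
    using subset_Zorn_nonempty[of \<A>] by metis
  have idl: "Q \<subseteq> R" "0 \<in> Q" "\<And>a b. a \<in> Q \<Longrightarrow> b \<in> Q \<Longrightarrow> a + b \<in> Q"
      "\<And>r a. r \<in> R \<Longrightarrow> a \<in> Q \<Longrightarrow> r * a \<in> Q" "1 \<notin> Q" "I \<subseteq> Q"
    using Q(1) unfolding \<A>_def idl_def by blast+
  have unit: "\<exists>m\<in>Q. \<exists>r\<in>R. 1 = m + a * r" if a: "a \<in> R" "a \<notin> Q" for a
  proof (rule ccontr)
    assume not1: "\<not> ?thesis"
    define J where "J = {m + a * r |m r. m \<in> Q \<and> r \<in> R}"
    have zR: "0 \<in> R"
      using idl by blast
    have QJ: "Q \<subseteq> J"
    proof
      fix m assume "m \<in> Q"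
      then have "m = m + a * 0 \<and> m \<in> Q \<and> 0 \<in> R"
        using zR by simp
      then show "m \<in> J"
        unfolding J_def by blast
    qed
    have "idl J"
      unfolding idl_def
    proof (intro conjI ballI)
      show "J \<subseteq> R"
        unfolding J_def using idl(1) R' a(1) by blast
      show "0 \<in> J"
        using QJ idl(2) by blast
      fix u assume "u \<in> J"
      then obtain m r where u: "u = m + a * r" "m \<in> Q" "r \<in> R"
        by (auto simp: J_def)
      {
        fix v assume "v \<in> J"
        then obtain m' r' where v: "v = m' + a * r'" "m' \<in> Q" "r' \<in> R"
          by (auto simp: J_def)
        have "u + v = (m + m') + a * (r + r')"
          by (simp add: u(1) v(1) algebra_simps)
        moreover have "m + m' \<in> Q" "r + r' \<in> R"
          using u v idl(3) R' by blast+
        ultimately show "u + v \<in> J"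
          unfolding J_def by blast
      }
      fix s assume "s \<in> R"
      have "s * u = s * m + a * (s * r)"
        by (simp add: u(1) algebra_simps)
      moreover have "s * m \<in> Q" "s * r \<in> R"
        using u idl(4) R' \<open>s \<in> R\<close> by blast+
      ultimately show "s * u \<in> J"
        unfolding J_def by blast
    qed
    moreover have "1 \<notin> J"
      using not1 unfolding J_def by blast
    ultimately have "J = Q"
      using Q(2)[OF _ QJ] QJ idl(6) unfolding \<A>_def by blast
    moreover have "a \<in> J"
    proof -
      have "a = 0 + a * 1 \<and> 0 \<in> Q \<and> 1 \<in> R"
        using idl(2) R' by simp
      then show ?thesis
        unfolding J_def by blast
    qed
    ultimately show False
      using a(2) by blast
  qed
  have "primeideal Q (ring_of_integers K)"
  proof (rule primeidealI)
    show "ideal Q (ring_of_integers K)"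
      by (rule ideal_ring_of_integersI[OF K]) (use idl in \<open>auto simp: R_def\<close>)
    show "cring (ring_of_integers K)"
      by (rule ring_of_integers_cring[OF K])
    show "carrier (ring_of_integers K) \<noteq> Q"
      using idl(5) R' unfolding R_def by blast
    fix a b assume a: "a \<in> carrier (ring_of_integers K)" and b: "b \<in> carrier (ring_of_integers K)"
      and "a \<otimes>\<^bsub>ring_of_integers K\<^esub> b \<in> Q"
    then have ab: "a * b \<in> Q" "a \<in> R" "b \<in> R"
      by (auto simp: R_def)
    show "a \<in> Q \<or> b \<in> Q"
    proof (rule ccontr)
      assume "\<not> ?thesis"
      then obtain m r m' r' where 1: "m \<in> Q" "r \<in> R" "1 = m + a * r" "m' \<in> Q" "r' \<in> R" "1 = m' + b * r'"
        using unit ab by meson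
      \<comment> \<open>Every product in the expansion contains a factor from \<open>Q\<close>:
        \<open>m\<close>, \<open>m'\<close> or \<open>a * b\<close>.\<close>
      have "1 = (m + a * r) * (m' + b * r')"
        using 1 by simp
      also have "\<dots> = m * m' + ((b * r') * m + ((a * r) * m' + (r * r') * (a * b)))"
        by (simp add: algebra_simps)
      also have "\<dots> \<in> Q"
      proof -
        have R: "m \<in> R" "b * r' \<in> R" "a * r \<in> R" "r * r' \<in> R"
          using 1 ab idl(1) R' by blast+
        show ?thesis
          by (intro idl(3) idl(4)[OF R(1) 1(4)] idl(4)[OF R(2) 1(1)] idl(4)[OF R(3) 1(4)]
              idl(4)[OF R(4) ab(1)])
      qed
      finally show False
        using idl(5) by blast
    qed
  qed
  then show ?thesis
    using that idl(6) by blast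
qed

text \<open>If \<open>y\<close> is a non-integral element of the inverse ideal of \<open>P\<close>, then the \<open>x\<close> with \<open>y * x\<close> integral
  form a proper ideal of the larger ring of integers that contains \<open>P\<close>.\<close>

lemma lying_over:
  assumes K: "number_field K" and L: "number_field L" and KL: "K \<subseteq> L" and P: "P \<in> nonzero_primes K"
  obtains Q where "Q \<in> nonzero_primes L" "Q \<inter> carrier (ring_of_integers K) = P"
proof -
  interpret P: number_field_prime K P
    by unfold_locales (use K P in auto)
  obtain y where y: "y \<in> K" "y \<notin> P.R" "\<And>x. x \<in> P \<Longrightarrow> y * x \<in> P.R"
    using P.ex_inverse_uniformizer by blast
  define S where "S = carrier (ring_of_integers L)"
  have S: "subring S ring_of_type_algebra"
    unfolding S_def by (rule ring_of_integers_subring[OF L])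
  note S' = S[unfolded subring_type_iff]
  have RS: "P.R \<subseteq> S"
    using KL by (auto simp: S_def)
  define I where "I = {x \<in> S. y * x \<in> S}"
  obtain Q where Q: "primeideal Q (ring_of_integers L)" "I \<subseteq> Q"
  proof (rule prime_ideal_containing[OF L, of I])
    \<comment> \<open>\<open>1 \<in> I\<close> would make \<open>y\<close> integral, but
      \<open>y\<close> is an element of \<open>K\<close> outside its ring of integers.\<close>
    show "1 \<notin> I"
      using y(1,2) by (auto simp: I_def S_def)
    show "I \<subseteq> carrier (ring_of_integers L)"
      by (auto simp: I_def S_def)
    show "0 \<in> I"
      using subringE(2)[OF S] by (simp add: I_def)
    show "a + b \<in> I" if "a \<in> I" "b \<in> I" for a b
      using that S' by (simp add: I_def distrib_left)
    show "r * a \<in> I" if "r \<in> carrier (ring_of_integers L)" "a \<in> I" for r a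
      using that S' unfolding S_def[symmetric] by (simp add: I_def mult.left_commute)
  qed
  have PQ: "P \<subseteq> Q"
    using Q(2) y(3) RS P.P_sub_R unfolding I_def by blast
  have "Q \<noteq> {0}"
    using PQ P.p_in_P P.p_nz by auto
  then have QL: "Q \<in> nonzero_primes L"
    using Q(1) by (simp add: nonzero_primes_def)
  interpret Q: number_field_prime L Q
    by unfold_locales (use L QL in auto)
  \<comment> \<open>An integer of \<open>K\<close> outside \<open>P\<close> is invertible modulo
    \<open>P\<close>, hence modulo \<open>Q\<close>, so it cannot lie in \<open>Q\<close>.\<close>
  have "a \<in> P" if a: "a \<in> Q" "a \<in> P.R" for a
  proof (rule ccontr)
    assume "a \<notin> P"
    then obtain r where r: "r \<in> P.R" "r * a - 1 \<in> P"
      using P.unit_mod_P a(2) by blast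
    then have "r * a - (r * a - 1) \<in> Q"
      using Q.P_diff[OF Q.P_mult[OF _ a(1)], of r "r * a - 1"] PQ RS unfolding S_def by blast
    then show False
      using Q.one_notin_P by simp
  qed
  then have "Q \<inter> P.R = P"
    using PQ P.P_sub_R by blast
  then show ?thesis
    using that QL by blast
qed

section \<open>Galois closures\<close>

definition poly_over :: "'a::field set \<Rightarrow> 'a poly \<Rightarrow> bool" where
  "poly_over F p \<longleftrightarrow> (\<forall>i. poly.coeff p i \<in> F)"

text \<open>Values may lie anywhere in the ambient field and are arbitrary outside \<open>F\<close>,
  so extending an embedding means finding a function that agrees with it on \<open>F\<close>.
  Injectivity is automatic when \<open>F\<close> is a field.\<close>

definition field_embedding :: "'a::field set \<Rightarrow> ('a \<Rightarrow> 'a) \<Rightarrow> bool" where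
  "field_embedding F \<sigma> \<longleftrightarrow> \<sigma> 1 = 1 \<and>
     (\<forall>a\<in>F. \<forall>b\<in>F. \<sigma> (a + b) = \<sigma> a + \<sigma> b \<and> \<sigma> (a * b) = \<sigma> a * \<sigma> b)"

lemma map_poly_pCons_hom:
  "f 0 = 0 \<Longrightarrow> map_poly f (pCons a p) = pCons (f a) (map_poly f p)"
  by (rule poly_eqI) (simp add: coeff_map_poly coeff_pCons split: nat.splits)

lemma poly_over_pCons [simp]:
  assumes "subring F ring_of_type_algebra"
  shows "poly_over F (pCons a p) \<longleftrightarrow> a \<in> F \<and> poly_over F p"
proof
  assume *: "poly_over F (pCons a p)"
  have "poly.coeff (pCons a p) 0 \<in> F" "poly.coeff (pCons a p) (Suc i) \<in> F" for i
    using * unfolding poly_over_def by blast+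
  then show "a \<in> F \<and> poly_over F p"
    by (simp add: poly_over_def)
qed (auto simp: poly_over_def coeff_pCons split: nat.splits)

lemma poly_over_0:
  "subring F (ring_of_type_algebra :: 'a::field ring) \<Longrightarrow> poly_over F 0"
  using subringE(2)[of F "ring_of_type_algebra :: 'a ring"] by (simp add: poly_over_def)

lemma poly_over_add:
  "subring F ring_of_type_algebra \<Longrightarrow> poly_over F p \<Longrightarrow> poly_over F q \<Longrightarrow> poly_over F (p + q)"
  by (simp add: poly_over_def subring_type_iff)

lemma poly_over_diff:
  "subring F ring_of_type_algebra \<Longrightarrow> poly_over F p \<Longrightarrow> poly_over F q \<Longrightarrow> poly_over F (p - q)"
  by (simp add: poly_over_def subring_type_diff)

lemma poly_over_smult:
  "subring F ring_of_type_algebra \<Longrightarrow> c \<in> F \<Longrightarrow> poly_over F p \<Longrightarrow> poly_over F (Polynomial.smult c p)"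
  by (simp add: poly_over_def subring_type_iff)

lemma poly_over_mult:
  assumes "subring F ring_of_type_algebra" "poly_over F p" "poly_over F q"
  shows "poly_over F (p * q)"
  unfolding poly_over_def coeff_mult
proof
  fix i
  have "poly.coeff p j * poly.coeff q (i - j) \<in> F" for j
    using assms unfolding poly_over_def subring_type_iff by blast
  then show "(\<Sum>j\<le>i. poly.coeff p j * poly.coeff q (i - j)) \<in> F"
    by (intro subring_type_sum[OF assms(1)])
qed

text \<open>Induction on the coefficients: \<open>pCons a r\<close> has degree at most that of
  \<open>m\<close>, and subtracting one multiple of \<open>m\<close> removes its coefficient at that
  degree.\<close>

lemma poly_over_divmod:
  assumes F: "subfield F ring_of_type_algebra" and m: "poly_over F m" "m \<noteq> 0" and p: "poly_over F p"
  shows "\<exists>d r. poly_over F d \<and> poly_over F r \<and> p = m * d + r \<and>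
    (r = 0 \<or> Polynomial.degree r < Polynomial.degree m)"
  using p
proof (induction p)
  case 0
  have "poly_over F 0"
    by (rule poly_over_0[OF subfieldE(1)[OF F]])
  then show ?case
    by (intro exI[of _ 0]) auto
next
  case (pCons a p)
  have SF: "subring F ring_of_type_algebra"
    by (rule subfieldE(1)[OF F])
  obtain d r where dr: "poly_over F d" "poly_over F r" "p = m * d + r"
      "r = 0 \<or> Polynomial.degree r < Polynomial.degree m"
    using pCons SF by auto
  define r1 where "r1 = pCons a r"
  define n where "n = Polynomial.degree m"
  define c where "c = poly.coeff r1 n / poly.coeff m n"
  define r2 where "r2 = r1 - Polynomial.smult c m"
  have r1: "poly_over F r1"
    using pCons.prems SF dr(2) by (simp add: r1_def)
  have "c \<in> F"
  proof -
    have "poly.coeff r1 n * inverse (poly.coeff m n) \<in> F"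
      using r1 m(1) F unfolding poly_over_def subfield_type_iff subring_type_iff by blast
    then show ?thesis
      by (simp add: c_def field_simps)
  qed
  then have r2: "poly_over F r2"
    unfolding r2_def using r1 m(1) SF by (intro poly_over_diff poly_over_smult)
  have "Polynomial.degree r1 \<le> n"
    using dr(4) by (auto simp: r1_def n_def)
  then have "Polynomial.degree r2 \<le> n"
    unfolding r2_def n_def by (intro degree_diff_le) auto
  moreover have "poly.coeff r2 n = 0"
    using m(2) by (simp add: r2_def c_def n_def)
  ultimately have "r2 = 0 \<or> Polynomial.degree r2 < n"
    by (metis leading_coeff_0_iff nat_less_le)
  moreover have "pCons a p = m * pCons c d + r2"
    by (simp add: dr(3) r2_def r1_def algebra_simps)
  moreover have "poly_over F (pCons c d)"
    using \<open>c \<in> F\<close> dr(1) SF by simp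
  ultimately show ?case
    using r2 unfolding n_def by blast
qed

text \<open>Remainders on division by a nonzero polynomial of least degree with root
  \<open>x\<close> vanish. This divisibility is what makes extensions of embeddings well
  defined.\<close>

lemma ex_minimal_poly_over:
  assumes F: "subfield F ring_of_type_algebra" and x: "p \<noteq> 0" "poly_over F p" "poly p x = 0"
  obtains m where "m \<noteq> 0" "poly_over F m" "poly m x = 0"
    "\<And>q. poly_over F q \<Longrightarrow> poly q x = 0 \<Longrightarrow> \<exists>d. poly_over F d \<and> q = m * d"
proof -
  define A where "A = {p. p \<noteq> 0 \<and> poly_over F p \<and> poly p x = 0}"
  define m where "m = arg_min Polynomial.degree (\<lambda>p. p \<in> A)"
  have "p \<in> A"
    using x by (simp add: A_def)
  then have m: "m \<in> A" "\<And>q. q \<in> A \<Longrightarrow> Polynomial.degree m \<le> Polynomial.degree q"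
    unfolding m_def using arg_min_natI[of "\<lambda>p. p \<in> A" p] arg_min_nat_le[of "\<lambda>p. p \<in> A"] by auto
  have "\<exists>d. poly_over F d \<and> q = m * d" if q: "poly_over F q" "poly q x = 0" for q
  proof -
    obtain d r where dr: "poly_over F d" "poly_over F r" "q = m * d + r"
        "r = 0 \<or> Polynomial.degree r < Polynomial.degree m"
      using poly_over_divmod[OF F _ _ q(1), of m] m(1) by (auto simp: A_def)
    have "poly r x = 0"
      using dr(3) q(2) m(1) by (simp add: A_def)
    then have "r \<in> A" if "r \<noteq> 0"
      using that dr(2) by (simp add: A_def)
    then have "r = 0"
      using dr(4) m(2)[of r] by linarith
    then show ?thesis
      using dr by auto
  qed
  then show ?thesis
    using that[of m] m(1) by (auto simp: A_def)
qed

text \<open>Simple extensions are generated by Horner steps \<open>k1 * x + k2\<close>, which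
  correspond to \<open>pCons k2\<close>.\<close>

lemma simple_extension_eq_poly:
  assumes F: "subring F (ring_of_type_algebra :: 'a::field ring)"
  shows "ring.simple_extension ring_of_type_algebra F x = {poly p x |p. poly_over F p}"
proof -
  interpret R: field "ring_of_type_algebra :: 'a ring"
    by (rule field_from_type_algebra)
  have "\<exists>p. z = poly p x \<and> poly_over F p" if "z \<in> R.simple_extension F x" for z
    using that
  proof (induction rule: R.simple_extension.induct)
    case zero
    show ?case
      using poly_over_0[OF F] by (intro exI[of _ 0]) auto
  next
    case (lin k1 k2)
    then obtain p where "k1 = poly p x" "poly_over F p"
      by blast
    then show ?case
      using lin(2) F by (intro exI[of _ "pCons k2 p"]) auto
  qed
  moreover have "poly p x \<in> R.simple_extension F x" if "poly_over F p" for p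
    using that
  proof (induction p)
    case 0
    show ?case
      using R.simple_extension.zero[of F x] by simp
  next
    case (pCons a p)
    then show ?case
      using R.simple_extension.lin[of "poly p x" F x a] F by (simp add: algebra_simps)
  qed
  ultimately show ?thesis
    by blast
qed

lemma field_embedding_0:
  assumes "subring F (ring_of_type_algebra :: 'a::field ring)" "field_embedding F \<sigma>"
  shows "\<sigma> 0 = (0::'a)"
proof -
  have "\<sigma> (0 + 0) = \<sigma> 0 + \<sigma> 0"
    using assms subringE(2)[OF assms(1)] unfolding field_embedding_def ring_of_type_algebra_simps
    by blast
  then show ?thesis
    by (metis add_0_right add_cancel_left_right)
qed

lemma field_embedding_eq_0:
  assumes "subfield F (ring_of_type_algebra :: 'a::field ring)" "field_embedding F \<sigma>" "a \<in> F" "\<sigma> a = 0"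
  shows "a = 0"
proof (rule ccontr)
  assume "a \<noteq> 0"
  have "inverse a \<in> F"
    using assms(1,3) unfolding subfield_type_iff by blast
  then have "\<sigma> (a * inverse a) = \<sigma> a * \<sigma> (inverse a)"
    using assms(2,3) unfolding field_embedding_def by blast
  then show False
    using \<open>a \<noteq> 0\<close> assms(2,4) by (simp add: field_embedding_def)
qed

lemma field_embedding_sum:
  assumes "subring F ring_of_type_algebra" "field_embedding F \<sigma>" "\<And>i. i \<in> I \<Longrightarrow> f i \<in> F"
  shows "\<sigma> (sum f I) = (\<Sum>i\<in>I. \<sigma> (f i))"
  using assms(3)
proof (induction I rule: infinite_finite_induct)
  case (insert i I)
  then show ?case
    using assms(2) subring_type_sum[OF assms(1), of I f] by (simp add: field_embedding_def)
qed (simp_all add: field_embedding_0[OF assms(1,2)])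

lemma map_poly_embedding_add:
  assumes "subring F ring_of_type_algebra" "field_embedding F \<sigma>" "poly_over F p" "poly_over F q"
  shows "map_poly \<sigma> (p + q) = map_poly \<sigma> p + map_poly \<sigma> q"
  using assms
  by (intro poly_eqI) (simp add: coeff_map_poly field_embedding_0[OF assms(1,2)] field_embedding_def poly_over_def)

lemma map_poly_embedding_mult:
  assumes "subring F ring_of_type_algebra" "field_embedding F \<sigma>" "poly_over F p" "poly_over F q"
  shows "map_poly \<sigma> (p * q) = map_poly \<sigma> p * map_poly \<sigma> q"
proof (rule poly_eqI)
  fix n
  have mem: "poly.coeff p i \<in> F" "poly.coeff q i \<in> F" for i
    using assms(3,4) by (auto simp: poly_over_def)
  have "\<sigma> (\<Sum>i\<le>n. poly.coeff p i * poly.coeff q (n - i)) =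
      (\<Sum>i\<le>n. \<sigma> (poly.coeff p i * poly.coeff q (n - i)))"
    by (intro field_embedding_sum[OF assms(1,2)]) (use mem assms(1) in \<open>auto simp: subring_type_iff\<close>)
  also have "\<dots> = (\<Sum>i\<le>n. \<sigma> (poly.coeff p i) * \<sigma> (poly.coeff q (n - i)))"
    using assms(2) mem by (simp add: field_embedding_def)
  finally show "poly.coeff (map_poly \<sigma> (p * q)) n = poly.coeff (map_poly \<sigma> p * map_poly \<sigma> q) n"
    by (simp add: coeff_map_poly coeff_mult field_embedding_0[OF assms(1,2)])
qed

text \<open>\<open>poly p x\<close> is sent to the value at \<open>y\<close> of the image of
  \<open>p\<close>. This is independent of \<open>p\<close>: two choices differ by a multiple of
  \<open>m\<close>, whose image vanishes at \<open>y\<close>.\<close>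

lemma field_embedding_extend:
  fixes F :: "'a::field set"
  assumes F: "subring F ring_of_type_algebra" and \<sigma>: "field_embedding F \<sigma>"
    and m: "poly_over F m" "\<And>q. poly_over F q \<Longrightarrow> poly q x = 0 \<Longrightarrow> \<exists>d. poly_over F d \<and> q = m * d"
    and y: "poly (map_poly \<sigma> m) y = 0"
  obtains \<tau> where "field_embedding (ring.simple_extension ring_of_type_algebra F x) \<tau>"
    "\<And>a. a \<in> F \<Longrightarrow> \<tau> a = \<sigma> a" "\<tau> x = y"
proof -
  have \<sigma>0: "\<sigma> 0 = 0"
    by (rule field_embedding_0[OF F \<sigma>])
  have F0: "0 \<in> F" and F1: "1 \<in> F"
    using subringE(2,3)[OF F] by simp_all
  define \<tau> where "\<tau> z = poly (map_poly \<sigma> (SOME p. poly_over F p \<and> poly p x = z)) y" for z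
  have \<tau>: "\<tau> (poly p x) = poly (map_poly \<sigma> p) y" if p: "poly_over F p" for p
  proof -
    define q where "q = (SOME q. poly_over F q \<and> poly q x = poly p x)"
    have q: "poly_over F q \<and> poly q x = poly p x"
      unfolding q_def by (rule someI[of _ p]) (use p in simp)
    then obtain d where d: "poly_over F d" "p - q = m * d"
      using m(2)[of "p - q"] poly_over_diff[OF F p] by auto
    have "map_poly \<sigma> p = map_poly \<sigma> (m * d + q)"
      using d(2) by (simp add: algebra_simps)
    also have "\<dots> = map_poly \<sigma> m * map_poly \<sigma> d + map_poly \<sigma> q"
      using q d(1) m(1) F \<sigma>
      by (simp add: map_poly_embedding_add map_poly_embedding_mult poly_over_mult)
    finally have "poly (map_poly \<sigma> p) y = poly (map_poly \<sigma> q) y"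
      using y by simp
    then show ?thesis
      by (simp add: \<tau>_def q_def)
  qed
  show ?thesis
  proof (rule that[of \<tau>])
    show "\<tau> x = y"
      using \<tau>[of "[:0, 1:]"] F0 F1 F \<sigma> \<sigma>0
      by (simp add: poly_over_0 map_poly_pCons_hom field_embedding_def)
    show "\<tau> a = \<sigma> a" if "a \<in> F" for a
      using \<tau>[of "[:a:]"] that F \<sigma>0 by (simp add: poly_over_0 map_poly_pCons_hom)
    have "\<tau> 1 = 1"
      using \<tau>[of "[:1:]"] F1 F \<sigma> \<sigma>0 by (simp add: poly_over_0 map_poly_pCons_hom field_embedding_def)
    moreover have "\<tau> (poly p x + poly q x) = \<tau> (poly p x) + \<tau> (poly q x)"
        "\<tau> (poly p x * poly q x) = \<tau> (poly p x) * \<tau> (poly q x)"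
      if "poly_over F p" "poly_over F q" for p q
      using \<tau>[of "p + q"] \<tau>[of "p * q"] \<tau>[of p] \<tau>[of q] that F \<sigma>
      by (simp_all add: poly_over_add poly_over_mult map_poly_embedding_add map_poly_embedding_mult)
    ultimately show "field_embedding (ring.simple_extension ring_of_type_algebra F x) \<tau>"
      unfolding field_embedding_def simple_extension_eq_poly[OF F] by blast
  qed
qed

section \<open>Algebraic elements and repeated extensions\<close>

lemma nat_pow_type: "x [^]\<^bsub>ring_of_type_algebra\<^esub> (n::nat) = (x ^ n :: 'a::field)"
proof -
  interpret R: field "ring_of_type_algebra :: 'a ring"
    by (rule field_from_type_algebra)
  show ?thesis
    by (induction n) (simp_all add: mult.commute)
qed

text \<open>\<open>ring.eval\<close> reads coefficients from the leading one down,
  \<open>Poly\<close> from the constant one up; hence the \<open>rev\<close>.\<close>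

lemma eval_type_rev:
  "ring.eval (ring_of_type_algebra :: 'a::field ring) (rev as) x = poly (Poly as) x"
proof -
  interpret R: field "ring_of_type_algebra :: 'a ring"
    by (rule field_from_type_algebra)
  show ?thesis
    by (induction as rule: rev_induct) (simp_all add: Poly_append poly_monom nat_pow_type)
qed

lemma algebraic_over_typeI:
  fixes F :: "'a::field set"
  assumes "p \<noteq> 0" "poly_over F p" "poly p x = 0"
  shows "(ring.algebraic ring_of_type_algebra over F) x"
proof -
  interpret R: field "ring_of_type_algebra :: 'a ring"
    by (rule field_from_type_algebra)
  show ?thesis
  proof (rule R.algebraicI[of "rev (coeffs p)"])
    show "rev (coeffs p) \<noteq> []"
      using assms(1) by simp
    have "set (coeffs p) \<subseteq> F"
      using assms(2) by (auto simp: coeffs_def poly_over_def)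
    then show "rev (coeffs p) \<in> carrier (univ_poly ring_of_type_algebra F)"
      using assms(1)
      by (auto simp: univ_poly_def polynomial_def hd_rev last_coeffs_eq_coeff_degree)
    show "R.eval (rev (coeffs p)) x = \<zero>\<^bsub>ring_of_type_algebra\<^esub>"
      using assms(3) by (simp add: eval_type_rev)
  qed
qed

lemma algebraic_iff_int_poly:
  fixes x :: "'a::field_char_0"
  shows "algebraic x \<longleftrightarrow> (\<exists>f::int poly. f \<noteq> 0 \<and> poly (map_poly of_int f) x = 0)"
proof
  assume "algebraic x"
  then show "\<exists>f::int poly. f \<noteq> 0 \<and> poly (map_poly of_int f) x = 0"
    by (elim algebraicE') blast
next
  assume "\<exists>f::int poly. f \<noteq> 0 \<and> poly (map_poly of_int f) x = 0"
  then obtain f :: "int poly" where f: "f \<noteq> 0" "poly (map_poly of_int f) x = 0"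
    by blast
  then show "algebraic x"
    by (intro algebraicI[of "map_poly of_int f"]) (auto simp: coeff_map_poly poly_eq_iff)
qed

lemma poly_over_of_int:
  assumes "subring F (ring_of_type_algebra :: 'a::field_char_0 ring)"
  shows "poly_over F (map_poly of_int f)"
  by (simp add: poly_over_def coeff_map_poly subring_type_of_int[OF assms])

lemma map_poly_of_int_eq_0: "map_poly of_int f = (0 :: 'a::field_char_0 poly) \<longleftrightarrow> f = 0"
  by (simp add: poly_eq_iff coeff_map_poly)

lemma algebraic_poly_over:
  assumes "algebraic x" "subring F (ring_of_type_algebra :: 'a::field_char_0 ring)"
  obtains p where "p \<noteq> 0" "poly_over F p" "poly p x = 0"
  using assms(1) poly_over_of_int[OF assms(2)] map_poly_of_int_eq_0 unfolding algebraic_iff_int_poly by metis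

lemma algebraic_over:
  assumes "algebraic x" "subring F (ring_of_type_algebra :: 'a::field_char_0 ring)"
  shows "(ring.algebraic ring_of_type_algebra over F) x"
  using algebraic_poly_over[OF assms] algebraic_over_typeI by metis

text \<open>The generators are adjoined one at a time. By injectivity the image of a minimal
  polynomial keeps its degree, so it has a root in the algebraically closed ambient field, and this
  root becomes the image of the new generator.\<close>

lemma field_embedding_extend_list:
  fixes F :: "'a::{alg_closed_field,field_char_0} set"
  assumes F: "subfield F ring_of_type_algebra" and \<sigma>: "field_embedding F \<sigma>"
    and xs: "\<And>x. x \<in> set xs \<Longrightarrow> algebraic x"
  shows "subfield (ring.finite_extension ring_of_type_algebra F xs) ring_of_type_algebra \<and>
    (\<exists>\<tau>. field_embedding (ring.finite_extension ring_of_type_algebra F xs) \<tau> \<and> (\<forall>a\<in>F. \<tau> a = \<sigma> a))"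
proof -
  interpret R: field "ring_of_type_algebra :: 'a ring"
    by (rule field_from_type_algebra)
  show ?thesis
    using xs
  proof (induction xs)
    case Nil
    then show ?case
      using F \<sigma> by auto
  next
    case (Cons x xs)
    define E where "E = R.finite_extension F xs"
    obtain \<tau> where E: "subfield E ring_of_type_algebra" and \<tau>: "field_embedding E \<tau>" "\<forall>a\<in>F. \<tau> a = \<sigma> a"
      using Cons unfolding E_def by auto
    have SE: "subring E ring_of_type_algebra"
      by (rule subfieldE(1)[OF E])
    have FE: "F \<subseteq> E"
      unfolding E_def by (intro R.finite_extension_incl) simp_all
    have x: "algebraic x"
      using Cons.prems by simp
    obtain p where p: "p \<noteq> 0" "poly_over E p" "poly p x = 0"
      using algebraic_poly_over[OF x SE] by blast
    obtain m where m: "m \<noteq> 0" "poly_over E m" "poly m x = 0"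
      "\<And>q. poly_over E q \<Longrightarrow> poly q x = 0 \<Longrightarrow> \<exists>d. poly_over E d \<and> q = m * d"
      using ex_minimal_poly_over[OF E p] by blast
    have "Polynomial.degree m \<noteq> 0"
      using m(1,3) by (auto elim!: degree_eq_zeroE)
    moreover have "Polynomial.degree (map_poly \<tau> m) = Polynomial.degree m"
    proof (rule map_poly_degree_eq)
      show "\<tau> (Polynomial.lead_coeff m) \<noteq> 0"
        using field_embedding_eq_0[OF E \<tau>(1), of "Polynomial.lead_coeff m"] m(1,2)
        by (auto simp: poly_over_def)
    qed
    ultimately obtain y where y: "poly (map_poly \<tau> m) y = 0"
      using alg_closed_imp_poly_has_root[of "map_poly \<tau> m"] by auto
    obtain \<upsilon> where \<upsilon>: "field_embedding (R.simple_extension E x) \<upsilon>" "\<And>a. a \<in> E \<Longrightarrow> \<upsilon> a = \<tau> a"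
      using field_embedding_extend[OF SE \<tau>(1) m(2) _ y, of x] m(4) by blast
    have "subfield (R.simple_extension E x) ring_of_type_algebra"
      using R.simple_extension_is_subfield[OF E, of x] algebraic_over[OF x SE] by simp
    moreover have "R.finite_extension F (x # xs) = R.simple_extension E x"
      by (simp add: E_def)
    moreover have "\<forall>a\<in>F. \<upsilon> a = \<sigma> a"
      using \<upsilon>(2) \<tau>(2) FE by auto
    ultimately show ?case
      using \<upsilon>(1) by auto
  qed
qed

lemma number_field_algebraic:
  assumes K: "number_field K" and x: "x \<in> K"
  shows "algebraic x"
proof -
  obtain n :: nat where n: "\<And>m x. m > n \<Longrightarrow> (\<And>i. i < m \<Longrightarrow> x i \<in> K) \<Longrightarrow>
       \<exists>c::nat \<Rightarrow> int. (\<exists>i<m. c i \<noteq> 0) \<and> (\<Sum>i<m. of_int (c i) * x i) = 0"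
    using number_field_dependent[OF K] by blast
  have "\<exists>c::nat \<Rightarrow> int. (\<exists>i<Suc n. c i \<noteq> 0) \<and> (\<Sum>i<Suc n. of_int (c i) * x ^ i) = 0"
    by (rule n) (auto intro: subring_type_power[OF number_field_subring[OF K] x])
  then obtain c :: "nat \<Rightarrow> int" where
    c: "(\<exists>i<Suc n. c i \<noteq> 0) \<and> (\<Sum>i<Suc n. of_int (c i) * x ^ i) = 0" ..
  define f where "f = (\<Sum>i<Suc n. Polynomial.monom (c i) i)"
  have coeff: "poly.coeff f i = (if i < Suc n then c i else 0)" for i
    by (simp add: f_def coeff_sum del: sum.lessThan_Suc)
  have "f \<noteq> 0"
    using c coeff by (metis coeff_0)
  moreover have "map_poly of_int f = (\<Sum>i<Suc n. Polynomial.monom (of_int (c i)) i :: 'a poly)"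
    by (rule poly_eqI) (simp add: coeff_map_poly coeff coeff_sum del: sum.lessThan_Suc)
  then have "poly (map_poly of_int f) x = 0"
    using c by (simp add: poly_sum poly_monom del: sum.lessThan_Suc)
  ultimately show ?thesis
    unfolding algebraic_iff_int_poly by blast
qed

lemma field_embedding_int_poly:
  assumes F: "subring F (ring_of_type_algebra :: 'a::field_char_0 ring)" and \<tau>: "field_embedding F \<tau>"
    and fixes_rat: "\<And>a. a \<in> \<rat> \<Longrightarrow> \<tau> a = a" and x: "x \<in> F"
  shows "\<tau> (poly (map_poly of_int f) x) = poly (map_poly of_int f) (\<tau> x)"
proof (induction f)
  case 0
  show ?case
    using fixes_rat[of 0] by simp
next
  case (pCons a f)
  have "poly (map_poly of_int f) x \<in> F" "of_int a \<in> F"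
    by (intro subring_type_int_poly[OF F x] subring_type_of_int[OF F])+
  then show ?case
    using \<tau> F x pCons.IH fixes_rat[of "of_int a"]
    by (simp add: map_poly_pCons_hom field_embedding_def subring_type_iff)
qed

section \<open>Irreducible rational polynomials and conjugates\<close>

lemma map_poly_of_rat_add:
  "map_poly of_rat (p + q) = (map_poly of_rat p + map_poly of_rat q :: 'a::field_char_0 poly)"
  by (rule poly_eqI) (simp add: coeff_map_poly of_rat_add)

lemma map_poly_of_rat_mult:
  "map_poly of_rat (p * q) = (map_poly of_rat p * map_poly of_rat q :: 'a::field_char_0 poly)"
  by (rule poly_eqI) (simp add: coeff_map_poly coeff_mult of_rat_sum of_rat_mult)

text \<open>Otherwise \<open>f\<close> and \<open>g\<close> are coprime, and a Bezout identity
  evaluated at the common root gives 0 = 1.\<close>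

lemma irreducible_rat_poly_dvd:
  fixes x :: "'a::field_char_0" and f g :: "rat poly"
  assumes f: "irreducible f" "poly (map_poly of_rat f) x = 0" and g: "poly (map_poly of_rat g) x = 0"
  shows "f dvd g"
proof (rule ccontr)
  assume "\<not> f dvd g"
  moreover have "prime_elem f"
    using f(1) by (rule irreducible_imp_prime_elem_gcd)
  ultimately have "gcd f g = 1"
    using prime_elem_imp_coprime coprime_imp_gcd_eq_1 by blast
  then obtain a b where "a * f + b * g = 1"
    using bezout_coefficients_fst_snd[of f g] by metis
  then have "poly (map_poly of_rat (a * f + b * g)) x = (1 :: 'a)"
    by simp
  then show False
    using f(2) g by (simp add: map_poly_of_rat_add map_poly_of_rat_mult)
qed

text \<open>Separability in characteristic 0: \<open>f\<close> would divide \<open>pderiv f\<close>,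
  which is nonzero of smaller degree.\<close>

lemma irreducible_rat_poly_simple_root:
  fixes x :: "'a::field_char_0" and f :: "rat poly"
  assumes f: "irreducible f" "poly (map_poly of_rat f) x = 0"
  shows "poly (pderiv (map_poly of_rat f)) x \<noteq> 0"
proof
  have *: "pderiv (map_poly of_rat f) = (map_poly of_rat (pderiv f) :: 'a poly)"
    by (rule poly_eqI) (simp add: coeff_map_poly coeff_pderiv of_rat_mult of_rat_add)
  assume "poly (pderiv (map_poly of_rat f)) x = 0"
  then have "f dvd pderiv f"
    using irreducible_rat_poly_dvd[OF f, of "pderiv f"] by (simp add: *)
  moreover have deg: "Polynomial.degree f \<noteq> 0"
  proof
    assume "Polynomial.degree f = 0"
    then obtain c where "f = [:c:]"
      by (auto elim!: degree_eq_zeroE)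
    then have "f = 0"
      using f(2) by (simp add: map_poly_pCons_hom)
    then show False
      using f(1) by simp
  qed
  ultimately have "Polynomial.degree f \<le> Polynomial.degree (pderiv f)"
    by (intro dvd_imp_degree_le) (auto simp: pderiv_eq_0_iff)
  then show False
    using deg by (simp add: degree_pderiv)
qed

lemma rat_poly_splits_distinct:
  fixes f :: "rat poly"
  assumes f: "irreducible f"
  obtains c and as :: "'a::{alg_closed_field,field_char_0} list" where
    "distinct as" "map_poly of_rat f = Polynomial.smult c (\<Prod>a\<leftarrow>as. [:- a, 1:])"
    "\<And>a. a \<in> set as \<Longrightarrow> poly (map_poly of_rat f) a = 0"
proof -
  define g where "g = (map_poly of_rat f :: 'a poly)"
  have "f \<noteq> 0"
    using f by auto
  then have "g \<noteq> 0"
    by (simp add: g_def poly_eq_iff coeff_map_poly)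
  then obtain A where A: "g = Polynomial.smult (Polynomial.lead_coeff g) (\<Prod>x\<in>#A. [:- x, 1:])"
    using alg_closed_imp_factorization by blast
  define c where "c = Polynomial.lead_coeff g"
  obtain as where as: "mset as = A"
    using ex_mset by blast
  have g: "g = Polynomial.smult c (\<Prod>a\<leftarrow>as. [:- a, 1:])"
    using A unfolding c_def as[symmetric] by (simp flip: prod_mset_prod_list mset_map)
  have root: "poly g a = 0" if a: "a \<in> set as" for a
    unfolding g poly_smult poly_prod_list using a by (force simp: prod_list_zero_iff)
  have "distinct as"
  proof (rule ccontr)
    assume "\<not> distinct as"
    then obtain xs ys zs a where "as = xs @ [a] @ ys @ [a] @ zs"
      using not_distinct_decomp by blast
    then have "g = [:- a, 1:] * ([:- a, 1:] *
        Polynomial.smult c ((\<Prod>a\<leftarrow>xs. [:- a, 1:]) * (\<Prod>a\<leftarrow>ys. [:- a, 1:]) * (\<Prod>a\<leftarrow>zs. [:- a, 1:])))"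
      unfolding g by (simp add: mult_ac del: mult_pCons_left mult_pCons_right)
    then obtain h where "g = [:- a, 1:] * ([:- a, 1:] * h)"
      by blast
    then have "poly g a = 0" "poly (pderiv g) a = 0"
      by (simp_all add: pderiv_mult del: mult_pCons_left mult_pCons_right)
    then show False
      using irreducible_rat_poly_simple_root[OF f, of a] by (simp add: g_def)
  qed
  then show ?thesis
    using that[of as c] g root by (simp add: g_def)
qed

text \<open>By divisibility \<open>f\<close> acts as a minimal polynomial of \<open>x\<close>, so
  the identity on the rationals extends with \<open>y\<close> as the image of
  \<open>x\<close>.\<close>

lemma ex_conjugate_embedding:
  fixes x y :: "'a::{alg_closed_field,field_char_0}" and f :: "rat poly"
  assumes f: "irreducible f" "poly (map_poly of_rat f) x = 0" "poly (map_poly of_rat f) y = 0"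
  obtains \<tau> where "field_embedding (ring.simple_extension ring_of_type_algebra \<rat> x) \<tau>"
    "\<And>a. a \<in> \<rat> \<Longrightarrow> \<tau> a = a" "\<tau> x = y"
proof -
  have Q: "subring \<rat> (ring_of_type_algebra :: 'a ring)"
    by (rule subfieldE(1)[OF subfield_Rats])
  have over: "poly_over \<rat> (map_poly of_rat g :: 'a poly)" for g :: "rat poly"
    by (simp add: poly_over_def coeff_map_poly)
  have dvd: "\<exists>d. poly_over \<rat> d \<and> q = map_poly of_rat f * d" if q: "poly_over \<rat> q" "poly q x = 0" for q
  proof -
    have "\<forall>i. \<exists>r. poly.coeff q i = of_rat r"
      using q(1) by (auto simp: poly_over_def elim!: Rats_cases)
    then obtain r where r: "\<And>i. poly.coeff q i = of_rat (r i)"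
      by metis
    define q' where "q' = (\<Sum>i\<le>Polynomial.degree q. Polynomial.monom (r i) i)"
    have qq: "q = map_poly of_rat q'"
    proof (rule poly_eqI)
      fix i
      have "poly.coeff q' i = (if i \<le> Polynomial.degree q then r i else 0)"
        by (simp add: q'_def coeff_sum)
      then show "poly.coeff q i = poly.coeff (map_poly of_rat q') i"
        using r[of i] by (auto simp: coeff_map_poly coeff_eq_0)
    qed
    then obtain d where "q' = f * d"
      using irreducible_rat_poly_dvd[OF f(1,2), of q'] q(2) by blast
    then show ?thesis
      using over[of d] by (auto simp: qq map_poly_of_rat_mult)
  qed
  have id: "field_embedding \<rat> (\<lambda>a. a :: 'a)"
    by (simp add: field_embedding_def)
  have "poly (map_poly (\<lambda>a. a) (map_poly of_rat f)) y = 0"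
    using f(3) by (simp add: map_poly_idI)
  from field_embedding_extend[OF Q id over dvd this] show ?thesis
    using that by blast
qed

text \<open>\<open>L\<close> is generated by all roots of an integer polynomial \<open>g\<close>
  that vanishes on a spanning list of \<open>K\<close>. For normality, an embedding that takes
  \<open>x\<close> to a conjugate \<open>y\<close> is extended to a field containing
  \<open>L\<close>; it sends roots of \<open>g\<close> to roots of \<open>g\<close>, hence
  \<open>L\<close> into \<open>L\<close>.\<close>

lemma ex_galois_overfield:
  fixes K :: "'a::{alg_closed_field,field_char_0} set"
  assumes K: "number_field K"
  shows "\<exists>L. number_field L \<and> K \<subseteq> L \<and> galois_over_rationals L"
proof -
  interpret R: field "ring_of_type_algebra :: 'a ring"
    by (rule field_from_type_algebra)
  note Q = subfield_Rats
  have SQ: "subring \<rat> (ring_of_type_algebra :: 'a ring)"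
    by (rule subfieldE(1)[OF Q])
  obtain n where "R.dimension n \<rat> K"
    using K unfolding number_field_def R.finite_dimension_def by blast
  then obtain us where us: "R.Span \<rat> us = K"
    using R.exists_base[OF Q] by blast
  have usK: "set us \<subseteq> K"
    using R.Span_base_incl[OF Q, of us] us by simp
  have "\<exists>f::int poly. u \<in> set us \<longrightarrow> f \<noteq> 0 \<and> poly (map_poly of_int f) u = 0" for u
    using number_field_algebraic[OF K] usK unfolding algebraic_iff_int_poly by blast
  then obtain f :: "'a \<Rightarrow> int poly" where
    f: "\<And>u. u \<in> set us \<Longrightarrow> f u \<noteq> 0 \<and> poly (map_poly of_int (f u)) u = 0"
    by metis
  define g where "g = (\<Prod>u\<in>set us. f u)"
  have g: "g \<noteq> 0"
    using f by (simp add: g_def)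
  have map_g: "map_poly of_int g = (\<Prod>u\<in>set us. map_poly of_int (f u) :: 'a poly)"
    unfolding g_def by (simp add: of_int_poly_hom.hom_prod)
  define Z where "Z = {z :: 'a. poly (map_poly of_int g) z = 0}"
  have "finite Z"
    unfolding Z_def by (rule poly_roots_finite) (simp add: map_poly_of_int_eq_0 g)
  then obtain xs where xs: "set xs = Z"
    using finite_list by blast
  have usZ: "set us \<subseteq> Z"
    using f by (auto simp: Z_def map_g poly_prod)
  have alg: "algebraic z" if "z \<in> set xs" for z
    using that g unfolding xs Z_def algebraic_iff_int_poly by blast
  have algQ: "(R.algebraic over \<rat>) z" if "z \<in> set xs" for z
    using algebraic_over[OF alg[OF that] SQ] .
  define L where "L = R.finite_extension \<rat> xs"
  have L: "number_field L"
    unfolding number_field_def L_def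
    using R.finite_extension_is_subfield[OF Q, of xs] R.finite_extension_finite_dimension(1)[OF Q, of xs] algQ
    by auto
  have SL: "subring L ring_of_type_algebra"
    by (rule number_field_subring[OF L])
  have ZL: "Z \<subseteq> L"
    using R.finite_extension_mem[OF SQ, of xs] xs by (simp add: L_def)
  have "subalgebra \<rat> L ring_of_type_algebra"
    using R.finite_dimension_imp_subalgebra[OF Q] L unfolding number_field_def by blast
  then have KL: "K \<subseteq> L"
    using R.subalgebra_Span_incl[OF Q, of L us] us usZ ZL by blast
  have conj: "y \<in> L"
    if h: "irreducible h" "x \<in> L" "poly (map_poly of_rat h) x = 0" "poly (map_poly of_rat h) y = 0"
    for h :: "rat poly" and x y
  proof -
    obtain \<sigma> where \<sigma>: "field_embedding (R.simple_extension \<rat> x) \<sigma>" "\<And>a. a \<in> \<rat> \<Longrightarrow> \<sigma> a = a" "\<sigma> x = y"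
      using ex_conjugate_embedding[OF h(1,3,4)] by blast
    define E where "E = R.simple_extension \<rat> x"
    have QE: "\<rat> \<subseteq> E"
      unfolding E_def by (rule R.simple_extension_incl) simp_all
    have xE: "x \<in> E"
      unfolding E_def by (rule R.simple_extension_mem[OF SQ]) simp
    have E: "subfield E ring_of_type_algebra"
      unfolding E_def using R.simple_extension_is_subfield[OF Q, of x]
        algebraic_over[OF number_field_algebraic[OF L h(2)] SQ] by simp
    define M where "M = R.finite_extension E xs"
    obtain \<tau> where M: "subfield M ring_of_type_algebra" and \<tau>: "field_embedding M \<tau>" "\<forall>a\<in>E. \<tau> a = \<sigma> a"
      using field_embedding_extend_list[OF E \<sigma>(1)[folded E_def], of xs] alg unfolding M_def by blast
    have SM: "subring M ring_of_type_algebra"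
      by (rule subfieldE(1)[OF M])
    have EM: "E \<subseteq> M"
      unfolding M_def by (rule R.finite_extension_incl) simp_all
    have ZM: "Z \<subseteq> M"
      using R.finite_extension_mem[OF subfieldE(1)[OF E], of xs] xs by (simp add: M_def)
    have fixQ: "\<tau> a = a" if "a \<in> \<rat>" for a
      using \<tau>(2) QE \<sigma>(2) that by auto
    \<comment> \<open>The elements that \<open>\<tau>\<close> sends into \<open>L\<close> form a
      subring containing the rationals and the generators of \<open>L\<close>, hence all of
      \<open>L\<close> and in particular \<open>x\<close>.\<close>
    define H where "H = {z \<in> M. \<tau> z \<in> L}"
    have "subring H ring_of_type_algebra"
      unfolding subring_type_iff
    proof (intro conjI ballI)
      show "1 \<in> H"
        using SM SL fixQ[of 1] by (simp add: H_def subring_type_iff)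
      fix a assume a: "a \<in> H"
      have "\<tau> ((-1) * a) = \<tau> (-1) * \<tau> a"
        using \<tau>(1) a SM unfolding field_embedding_def H_def subring_type_iff by blast
      then have "\<tau> (- a) = - \<tau> a"
        using fixQ[of "-1"] by simp
      then show "- a \<in> H"
        using a SM SL by (simp add: H_def subring_type_iff)
      fix b assume b: "b \<in> H"
      show "a + b \<in> H" "a * b \<in> H"
        using a b SM SL \<tau>(1) by (simp_all add: H_def subring_type_iff field_embedding_def)
    qed
    moreover have "\<rat> \<subseteq> H"
      using fixQ QE EM Rats_subset_subfield[of L] L by (auto simp: H_def number_field_def)
    moreover have "Z \<subseteq> H"
    proof
      fix z assume z: "z \<in> Z"
      have "poly (map_poly of_int g) (\<tau> z) = \<tau> (poly (map_poly of_int g) z)"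
        using field_embedding_int_poly[OF SM \<tau>(1) fixQ, of z g] z ZM by auto
      also have "\<dots> = 0"
        using z fixQ[of 0] by (simp add: Z_def)
      finally have "\<tau> z \<in> Z"
        by (simp add: Z_def)
      then show "z \<in> H"
        using z ZM ZL by (auto simp: H_def)
    qed
    ultimately have "L \<subseteq> H"
      unfolding L_def by (intro R.finite_extension_subring_incl) (simp_all add: xs)
    then show "y \<in> L"
      using h(2) \<tau>(2) xE \<sigma>(3) by (auto simp: H_def)
  qed
  have "galois_over_rationals L"
    unfolding galois_over_rationals_def
  proof (intro allI impI, elim conjE bexE)
    fix h :: "rat poly" and x assume h: "irreducible h" "x \<in> L" "poly (map_poly of_rat h) x = 0"
    obtain c and as :: "'a list" where as: "distinct as"
        "map_poly of_rat h = Polynomial.smult c (\<Prod>a\<leftarrow>as. [:- a, 1:])"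
        "\<And>a. a \<in> set as \<Longrightarrow> poly (map_poly of_rat h) a = 0"
      using rat_poly_splits_distinct[OF h(1)] by blast
    then have "set as \<subseteq> L"
      using conj[OF h] by blast
    then show "\<exists>c as. distinct as \<and> set as \<subseteq> L \<and>
        map_poly of_rat h = Polynomial.smult c (\<Prod>a\<leftarrow>as. [:- a, 1:])"
      using as by blast
  qed
  with L KL show ?thesis
    by blast
qed

lemma galois_overfield:
  assumes "number_field K"
  shows "number_field (galois_overfield K)" "K \<subseteq> galois_overfield K"
  using someI_ex[OF ex_galois_overfield[OF assms]] unfolding galois_overfield_def by blast+

section \<open>The difference quotients\<close>

text \<open>The quotient is exactly \<open>a\<close> for pairs arbitrarily near 0, so
  \<open>N (a - l)\<close> is below every positive number.\<close>

lemma strict_derivative_unique: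
  assumes l: "\<And>\<epsilon>::real. \<epsilon> > 0 \<Longrightarrow> \<exists>\<delta>>0. \<forall>u\<in>K. \<forall>v\<in>K. u \<noteq> v \<and> N (u - 0) < \<delta> \<and> N (v - 0) < \<delta> \<longrightarrow>
      N ((f u - f v) / (u - v) - l) < \<epsilon>"
    and N: "\<And>x::'a::field. (\<And>\<epsilon>::real. \<epsilon> > 0 \<Longrightarrow> N x < \<epsilon>) \<Longrightarrow> x = 0"
    and a: "\<And>\<delta>::real. \<delta> > 0 \<Longrightarrow> \<exists>u\<in>K. \<exists>v\<in>K. u \<noteq> v \<and> N u < \<delta> \<and> N v < \<delta> \<and> (f u - f v) / (u - v) = a"
  shows "a = l"
proof -
  have "N (a - l) < \<epsilon>" if \<epsilon>: "\<epsilon> > 0" for \<epsilon>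
  proof -
    obtain \<delta> where \<delta>: "\<delta> > 0" "\<forall>u\<in>K. \<forall>v\<in>K. u \<noteq> v \<and> N (u - 0) < \<delta> \<and> N (v - 0) < \<delta> \<longrightarrow>
        N ((f u - f v) / (u - v) - l) < \<epsilon>"
      using l[OF \<epsilon>] by blast
    obtain u v where uv: "u \<in> K" "v \<in> K" "u \<noteq> v" "N u < \<delta>" "N v < \<delta>" "(f u - f v) / (u - v) = a"
      using a[OF \<delta>(1)] by blast
    then have "N ((f u - f v) / (u - v) - l) < \<epsilon>"
      using \<delta>(2)[rule_format, of u v] by simp
    then show ?thesis
      by (simp add: uv(6))
  qed
  then show ?thesis
    using N[of "a - l"] by simp
qed

lemma multiplicity_prime_powers:
  fixes l p q :: nat
  assumes "prime l" "prime p" "prime q"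
  shows "multiplicity (int l) (int p ^ n * int q ^ j) = (if l = p then n else 0) + (if l = q then j else 0)"
proof -
  have *: "multiplicity (int l) (int r ^ k) = (if l = r then k else 0)" if "prime r" for r k
    using that assms(1) by (auto simp: multiplicity_distinct_prime_power)
  have "int p \<noteq> 0" "int q \<noteq> 0"
    using assms by auto
  then show ?thesis
    using assms by (simp add: prime_elem_multiplicity_mult_distrib *)
qed

section \<open>Absolute values and subderivatives of rational numbers\<close>

context number_field_prime
begin

lemma prime_abs_of_int_divide:
  assumes "a \<noteq> 0" "b \<noteq> 0" "0 < c"
    and "multiplicity (int p) a = multiplicity (int p) b + n"
  shows "prime_abs c K P (of_int a / of_int b) = c ^ n"
proof -
  have "prime_val K P (of_int a / of_int b) = of_nat n"
    using prime_val_of_int_divide[OF assms(1,2)] assms(4) by simp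
  then show ?thesis
    using assms(1-3) by (simp add: prime_abs_def powr_realpow)
qed

text \<open>Finiteness matters here, because \<open>card\<close> of an infinite set is 0.\<close>

lemma num_primes_over_pos: "num_primes_over p K > 0"
  unfolding num_primes_over_def
  using finite_primes_over[OF K p_prime] P p_in_P by (auto simp: card_gt_0_iff)

end

text \<open>The defining sum runs over a support that varies with the argument. Any finite
  \<open>S\<close> outside which numerator and denominator have equal multiplicities may replace it,
  and \<open>of_rat\<close> moves outside, so that the rest is a computation with rational
  weights.\<close>

lemma galois_subderivative_of_int_divide:
  fixes T :: "'a::{alg_closed_field,field_char_0} set set"
  assumes L: "number_field L" and T: "T \<subseteq> nonzero_primes L" and ab: "a \<noteq> 0" "b \<noteq> 0"
    and S: "finite S" "S \<subseteq> T"
      "\<And>Q. Q \<in> T - S \<Longrightarrow> multiplicity (int (rational_prime_below Q)) a = multiplicity (int (rational_prime_below Q)) b"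
  shows "galois_subderivative L T (of_int a / of_int b) = of_int a / of_int b *
    of_rat (\<Sum>Q\<in>S. (of_nat (multiplicity (int (rational_prime_below Q)) a) -
        of_nat (multiplicity (int (rational_prime_below Q)) b)) /
      of_nat (rational_prime_below Q * num_primes_over (rational_prime_below Q) L))"
proof -
  define x where "x = (of_int a / of_int b :: 'a)"
  have val: "prime_val L Q x = of_nat (multiplicity (int (rational_prime_below Q)) a) -
      of_nat (multiplicity (int (rational_prime_below Q)) b)" if "Q \<in> T" for Q
  proof -
    interpret Q: number_field_prime L Q
      by unfold_locales (use L T that in auto)
    show ?thesis
      unfolding x_def by (rule Q.prime_val_of_int_divide[OF ab])
  qed
  have "(\<Sum>Q \<in> {Q \<in> T. prime_val L Q x \<noteq> 0}.
        of_rat (prime_val L Q x / of_nat (rational_prime_below Q * num_primes_over (rational_prime_below Q) L))) =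
      (\<Sum>Q\<in>S. of_rat (prime_val L Q x /
        of_nat (rational_prime_below Q * num_primes_over (rational_prime_below Q) L)) :: 'a)"
  proof (rule sum.mono_neutral_left)
    show "{Q \<in> T. prime_val L Q x \<noteq> 0} \<subseteq> S"
    proof (rule subsetI, rule ccontr)
      fix Q assume Q: "Q \<in> {Q \<in> T. prime_val L Q x \<noteq> 0}" "Q \<notin> S"
      then show False
        using val[of Q] S(3)[of Q] by simp
    qed
  qed (use S in auto)
  also have "\<dots> = of_rat (\<Sum>Q\<in>S. prime_val L Q x /
      of_nat (rational_prime_below Q * num_primes_over (rational_prime_below Q) L))"
    by (simp only: of_rat_sum)
  also have "(\<Sum>Q\<in>S. prime_val L Q x /
        of_nat (rational_prime_below Q * num_primes_over (rational_prime_below Q) L)) =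
      (\<Sum>Q\<in>S. (of_nat (multiplicity (int (rational_prime_below Q)) a) -
          of_nat (multiplicity (int (rational_prime_below Q)) b)) /
        of_nat (rational_prime_below Q * num_primes_over (rational_prime_below Q) L))"
    by (rule sum.cong) (use val S(2) in auto)
  finally show ?thesis
    using ab unfolding galois_subderivative_def x_def[symmetric] by (simp add: x_def)
qed

theorem theorem5p8:
  fixes K :: "'a::{alg_closed_field,field_char_0} set"
    and P :: "'a set" and T :: "'a set set" and c :: real
  assumes "number_field K"
    and "P \<in> nonzero_primes K"
    and "T \<subseteq> nonzero_primes K" and "T \<noteq> {}"
    and "0 < c" and "c < 1"
  shows "\<not> strictly_differentiable_at K (prime_abs c K P) (arithmetic_subderivative K T) 0"
proof
  assume sd: "strictly_differentiable_at K (prime_abs c K P) (arithmetic_subderivative K T) 0"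
  interpret P: number_field_prime K P
    by unfold_locales fact+
  define L where "L = galois_overfield K"
  define S where "S = primes_over L K T"
  define N where "N = prime_abs c K P"
  define D where "D = galois_subderivative L S"
  define p where "p = rational_prime_below P"
  have L: "number_field L" "K \<subseteq> L"
    unfolding L_def by (rule galois_overfield[OF assms(1)])+
  have SL: "S \<subseteq> nonzero_primes L"
    by (auto simp: S_def primes_over_def)
  \<comment> \<open>Lying over: each prime in the nonempty \<open>T\<close> has a prime of
    \<open>L\<close> above it.\<close>
  have "S \<noteq> {}"
  proof -
    obtain P' where "P' \<in> T"
      using assms(4) by blast
    moreover then obtain Q where "Q \<in> nonzero_primes L" "Q \<inter> carrier (ring_of_integers K) = P'"
      using lying_over[OF assms(1) L, of P'] assms(3) by blast
    ultimately show ?thesis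
      by (auto simp: S_def primes_over_def)
  qed
  have p: "prime p"
    unfolding p_def by (rule P.p_prime)
  define A where "A q = {Q \<in> S. rational_prime_below Q = q}" for q
  have below: "prime (rational_prime_below Q) \<and> of_nat (rational_prime_below Q) \<in> Q \<and>
      num_primes_over (rational_prime_below Q) L > 0" if "Q \<in> S" for Q
  proof -
    interpret Q: number_field_prime L Q
      by unfold_locales (use L SL that in auto)
    show ?thesis
      using Q.rational_prime_below Q.num_primes_over_pos by blast
  qed
  have finA: "finite (A q)" for q
  proof (cases "prime q")
    case True
    have "A q \<subseteq> {Q \<in> nonzero_primes L. of_nat q \<in> Q}"
      using below SL by (auto simp: A_def)
    then show ?thesis
      by (rule finite_subset[OF _ finite_primes_over[OF L(1) True]])
  next
    case False
    then have "A q = {}"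
      using below by (auto simp: A_def)
    then show ?thesis
      by simp
  qed
  define w where "w Q = (1 / of_nat (rational_prime_below Q * num_primes_over (rational_prime_below Q) L) :: rat)" for Q :: "'a set"
  have w: "w Q > 0" if "Q \<in> S" for Q
    using below[OF that] prime_gt_0_nat by (simp add: w_def)
  define \<alpha> where "\<alpha> q = sum w (A q)" for q
  have \<alpha>_nonneg: "\<alpha> q \<ge> 0" for q
    unfolding \<alpha>_def by (intro sum_nonneg) (use w in \<open>auto simp: A_def less_imp_le\<close>)
  have \<alpha>_pos: "\<alpha> q > 0" if "A q \<noteq> {}" for q
    unfolding \<alpha>_def using that finA by (intro sum_pos) (use w in \<open>auto simp: A_def\<close>)
  obtain l where l: "\<And>\<epsilon>. \<epsilon> > 0 \<Longrightarrow> \<exists>\<delta>>0. \<forall>u\<in>K. \<forall>v\<in>K. u \<noteq> v \<and> N (u - 0) < \<delta> \<and> N (v - 0) < \<delta> \<longrightarrow>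
      N ((D u - D v) / (u - v) - l) < \<epsilon>"
    using sd unfolding strictly_differentiable_at_def arithmetic_subderivative_def
      N_def D_def S_def L_def by blast
  have N0: "x = 0" if "\<And>\<epsilon>. \<epsilon> > 0 \<Longrightarrow> N x < \<epsilon>" for x
  proof (rule ccontr)
    assume "x \<noteq> 0"
    then have "N x > 0"
      using assms(5) by (simp add: N_def prime_abs_def)
    from that[OF this] show False
      by simp
  qed
  note unique = strict_derivative_unique[of K N D l, OF l N0]
  have small: "\<exists>k\<ge>1. \<forall>n\<ge>k. c ^ n < \<delta>" if \<delta>: "\<delta> > 0" for \<delta>
  proof -
    obtain k where k: "c ^ k < \<delta>"
      using real_arch_pow_inv[OF \<delta> assms(6)] by blast
    have "c ^ n < \<delta>" if "n \<ge> Suc k" for n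
    proof -
      have "c ^ n \<le> c ^ k"
        using that assms(5,6) by (intro power_decreasing) auto
      then show ?thesis
        using k by simp
    qed
    then show ?thesis
      by (intro exI[of _ "Suc k"]) auto
  qed
  have inK: "of_int a / of_int b \<in> K" for a b
    by (rule number_field_divide[OF assms(1)])
      (auto intro: subring_type_of_int[OF number_field_subring[OF assms(1)]])
  show False
  proof (cases "\<exists>Q0\<in>S. rational_prime_below Q0 \<noteq> p")
    case True
    then obtain Q0 where Q0: "Q0 \<in> S" "rational_prime_below Q0 \<noteq> p"
      by blast
    define q where "q = rational_prime_below Q0"
    have q: "q \<noteq> p" "A q \<noteq> {}" "prime q"
      using Q0 below[OF Q0(1)] by (auto simp: A_def q_def)
    \<comment> \<open>\<open>r = t / s\<close> balances the weights:
      \<open>p ^ s * q ^ (- t)\<close> has subderivative 0. If no prime of \<open>S\<close> lies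
      over \<open>p\<close>, then \<open>\<alpha> p\<close>, \<open>r\<close> and \<open>t\<close>
      are all 0.\<close>
    define r where "r = \<alpha> p / \<alpha> q"
    have \<alpha>q: "\<alpha> q > 0"
      by (rule \<alpha>_pos[OF q(2)])
    then have "r \<ge> 0"
      using \<alpha>_nonneg by (simp add: r_def)
    obtain x y where xy: "r = of_int x / of_int y" "y > 0"
      by (cases r) (auto simp: Fract_of_int_quotient)
    have "x \<ge> 0"
      using xy \<open>r \<ge> 0\<close> by (simp add: zero_le_divide_iff)
    define s t where "s = nat y" and "t = nat x"
    have "\<alpha> p * of_nat s = of_nat t * \<alpha> q"
      using xy \<open>x \<ge> 0\<close> \<alpha>q by (simp add: s_def t_def r_def field_simps)
    have "s > 0"
      using xy(2) by (simp add: s_def)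
    have val: "of_rat (of_nat j * \<alpha> q) = l" for j
    proof (rule unique)
      fix \<delta> :: real assume "\<delta> > 0"
      then obtain k where k: "k \<ge> 1" "\<And>n. n \<ge> k \<Longrightarrow> c ^ n < \<delta>"
        using small by blast
      \<comment> \<open>\<open>u = p ^ (k s) q ^ (j - k t)\<close> tends to \<open>0\<close>, and \<open>D u / u = k s \<alpha>\<^sub>p + (j - k t) \<alpha>\<^sub>q = j \<alpha>\<^sub>q\<close>\<close>
      define a b where "a = int p ^ (k * s) * int q ^ j" and "b = int p ^ 0 * int q ^ (k * t)"
      have nz: "a \<noteq> 0" "b \<noteq> 0"
        using p q(3) by (auto simp: a_def b_def)
      have mult: "multiplicity (int m) a = (if m = p then k * s else 0) + (if m = q then j else 0)"
        "multiplicity (int m) b = (if m = q then k * t else 0)" if "prime m" for m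
        unfolding a_def b_def multiplicity_prime_powers[OF that p q(3)] by simp_all
      define u where "u = (of_int a / of_int b :: 'a)"
      have u0: "u \<noteq> 0"
        using nz by (simp add: u_def)
      have "N u = c ^ (k * s)"
        unfolding N_def u_def using nz assms(5) mult[OF p] q(1)
        by (intro P.prime_abs_of_int_divide) (auto simp: p_def)
      then have Nu: "N u < \<delta>"
        using k(2)[of "k * s"] \<open>s > 0\<close> by simp
      have "D u = u * of_rat (\<Sum>Q\<in>A p \<union> A q. (of_nat (multiplicity (int (rational_prime_below Q)) a) -
          of_nat (multiplicity (int (rational_prime_below Q)) b)) /
          of_nat (rational_prime_below Q * num_primes_over (rational_prime_below Q) L))"
        unfolding D_def u_def
      proof (rule galois_subderivative_of_int_divide[OF L(1) SL nz])
        fix Q assume "Q \<in> S - (A p \<union> A q)"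
        then show "multiplicity (int (rational_prime_below Q)) a = multiplicity (int (rational_prime_below Q)) b"
          using below[of Q] mult[of "rational_prime_below Q"] by (auto simp: A_def)
      qed (use finA in \<open>auto simp: A_def\<close>)
      also have "(\<Sum>Q\<in>A p \<union> A q. (of_nat (multiplicity (int (rational_prime_below Q)) a) -
          of_nat (multiplicity (int (rational_prime_below Q)) b)) /
          of_nat (rational_prime_below Q * num_primes_over (rational_prime_below Q) L)) =
          (\<Sum>Q\<in>A p \<union> A q. (of_nat (multiplicity (int (rational_prime_below Q)) a) -
          of_nat (multiplicity (int (rational_prime_below Q)) b)) * w Q)"
        by (simp add: w_def)
      also have "\<dots> = (\<Sum>Q\<in>A p. (of_nat (multiplicity (int (rational_prime_below Q)) a) -
          of_nat (multiplicity (int (rational_prime_below Q)) b)) * w Q) +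
          (\<Sum>Q\<in>A q. (of_nat (multiplicity (int (rational_prime_below Q)) a) -
          of_nat (multiplicity (int (rational_prime_below Q)) b)) * w Q)"
        using finA q(1) by (intro sum.union_disjoint) (auto simp: A_def)
      also have "(\<Sum>Q\<in>A p. (of_nat (multiplicity (int (rational_prime_below Q)) a) -
          of_nat (multiplicity (int (rational_prime_below Q)) b)) * w Q) = (\<Sum>Q\<in>A p. of_nat (k * s) * w Q)"
        by (rule sum.cong) (use mult[OF p] q(1) in \<open>auto simp: A_def\<close>)
      also have "(\<Sum>Q\<in>A q. (of_nat (multiplicity (int (rational_prime_below Q)) a) -
          of_nat (multiplicity (int (rational_prime_below Q)) b)) * w Q) =
          (\<Sum>Q\<in>A q. (of_nat j - of_nat (k * t)) * w Q)"
        by (rule sum.cong) (use mult[OF q(3)] q(1) in \<open>auto simp: A_def\<close>)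
      also have "(\<Sum>Q\<in>A p. of_nat (k * s) * w Q) + (\<Sum>Q\<in>A q. (of_nat j - of_nat (k * t)) * w Q) =
          of_nat k * (\<alpha> p * of_nat s) + (of_nat j - of_nat (k * t)) * \<alpha> q"
        unfolding \<alpha>_def sum_distrib_left[symmetric] by (simp add: mult_ac)
      also have "\<dots> = of_nat j * \<alpha> q"
        unfolding \<open>\<alpha> p * of_nat s = of_nat t * \<alpha> q\<close> by (simp add: algebra_simps)
      finally have "(D u - D 0) / (u - 0) = of_rat (of_nat j * \<alpha> q)"
        using u0 by (simp add: D_def galois_subderivative_def)
      moreover have "N 0 < \<delta>"
        using \<open>\<delta> > 0\<close> by (simp add: N_def prime_abs_def)
      ultimately show "\<exists>u\<in>K. \<exists>v\<in>K. u \<noteq> v \<and> N u < \<delta> \<and> N v < \<delta> \<and>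
          (D u - D v) / (u - v) = of_rat (of_nat j * \<alpha> q)"
        using u0 Nu inK[of a b] inK[of 0 1] unfolding u_def
        by (intro bexI[of _ "of_int a / of_int b"] bexI[of _ 0]) auto
    qed
    \<comment> \<open>\<open>j = 0\<close> and \<open>j = 1\<close> identify \<open>l\<close> with
      both 0 and the nonzero \<open>\<alpha> q\<close>.\<close>
    then show False
      using val[of 0] val[of 1] \<alpha>q by simp
  next
    case False
    then have SA: "S = A p"
      by (auto simp: A_def)
    have \<alpha>p: "\<alpha> p > 0"
      using \<alpha>_pos \<open>S \<noteq> {}\<close> SA by auto
    have D: "D (of_int a) = of_int a * of_rat (of_nat (multiplicity (int p) a) * \<alpha> p)" if "a \<noteq> 0" for a
    proof -
      have "D (of_int a / of_int 1) = of_int a / of_int 1 *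
          of_rat (\<Sum>Q\<in>S. (of_nat (multiplicity (int (rational_prime_below Q)) a) -
          of_nat (multiplicity (int (rational_prime_below Q)) 1)) /
          of_nat (rational_prime_below Q * num_primes_over (rational_prime_below Q) L))"
        unfolding D_def
        by (rule galois_subderivative_of_int_divide[OF L(1) SL that]) (use finA[of p] SA in auto)
      also have "(\<Sum>Q\<in>S. (of_nat (multiplicity (int (rational_prime_below Q)) a) -
          of_nat (multiplicity (int (rational_prime_below Q)) 1)) /
          of_nat (rational_prime_below Q * num_primes_over (rational_prime_below Q) L)) =
          (\<Sum>Q\<in>A p. of_nat (multiplicity (int p) a) * w Q)"
        unfolding SA by (rule sum.cong) (auto simp: A_def w_def)
      finally show ?thesis
        by (simp add: \<alpha>_def sum_distrib_left)
    qed
    have val: "of_rat (of_nat e * \<alpha> p) = l" for e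
    proof (rule unique)
      fix \<delta> :: real assume "\<delta> > 0"
      then obtain k where k: "k \<ge> 1" "\<And>n. n \<ge> k \<Longrightarrow> c ^ n < \<delta>"
        using small by blast
      \<comment> \<open>\<open>D\<close> has quotient \<open>\<alpha>\<^sub>p (n - k p ^ k)\<close> between \<open>p ^ n + p ^ (n + k)\<close> and \<open>p ^ (n + k)\<close>\<close>
      define n where "n = k * p ^ k + e"
      define a b where "a = int p ^ n * (1 + int p ^ k)" and "b = int p ^ (n + k)"
      have p0: "p > 0"
        using p prime_gt_0_nat by blast
      have nk: "n \<ge> k"
        using p0 by (simp add: n_def trans_le_add1)
      have "1 + int p ^ k > 0"
        using p0 by (simp add: add_pos_nonneg)
      then have nz: "a \<noteq> 0" "b \<noteq> 0"
        using p0 by (auto simp: a_def b_def)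
      \<comment> \<open>Here \<open>k \<ge> 1\<close> enters: \<open>p\<close> divides
        \<open>p ^ k\<close>, so the second factor of \<open>a\<close> is prime to \<open>p\<close>
        and \<open>a\<close> has multiplicity exactly \<open>n\<close>.\<close>
      have "\<not> int p dvd 1 + int p ^ k"
      proof
        assume "int p dvd 1 + int p ^ k"
        moreover have "int p dvd int p ^ k"
          using k(1) by (simp add: dvd_power)
        ultimately have "int p dvd 1"
          using dvd_add_left_iff by blast
        then show False
          using p by auto
      qed
      then have ma: "multiplicity (int p) a = n"
        unfolding a_def using p p0 \<open>1 + int p ^ k > 0\<close>
        by (subst prime_elem_multiplicity_mult_distrib) (auto simp: not_dvd_imp_multiplicity_0)
      have mb: "multiplicity (int p) b = n + k"
        unfolding b_def using p by simp
      define u v where "u = (of_int a :: 'a)" and "v = (of_int b :: 'a)"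
      have uv: "u - v = of_nat p ^ n"
        by (simp add: u_def v_def a_def b_def power_add algebra_simps)
      have "N (of_int a / of_int 1) = c ^ n"
        unfolding N_def using nz assms(5) ma
        by (intro P.prime_abs_of_int_divide) (auto simp: p_def)
      then have Nu: "N u < \<delta>"
        using k(2)[OF nk] by (simp add: u_def)
      have "N (of_int b / of_int 1) = c ^ (n + k)"
        unfolding N_def using nz assms(5) mb
        by (intro P.prime_abs_of_int_divide) (auto simp: p_def)
      then have Nv: "N v < \<delta>"
        using k(2)[of "n + k"] by (simp add: v_def)
      have "D u - D v = of_int a * (of_nat n * of_rat (\<alpha> p)) - of_int b * (of_nat (n + k) * of_rat (\<alpha> p))"
        unfolding u_def v_def using D[OF nz(1)] D[OF nz(2)] by (simp add: ma mb of_rat_mult of_rat_add)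
      \<comment> \<open>The terms \<open>n * p ^ (n + k)\<close> of both products cancel, which
        leaves \<open>p ^ n * (n - k * p ^ k)\<close> times the weight.\<close>
      also have "\<dots> = of_nat p ^ n * of_rat (\<alpha> p) * (of_nat n - of_nat (k * p ^ k))"
        by (simp add: a_def b_def power_add algebra_simps)
      also have "of_nat n - of_nat (k * p ^ k) = (of_nat e :: 'a)"
        by (simp add: n_def)
      finally have "(D u - D v) / (u - v) = of_rat (of_nat e * \<alpha> p)"
        using p0 by (simp add: uv of_rat_mult)
      moreover have "u \<noteq> v"
        using uv p0 by auto
      moreover have "u \<in> K" "v \<in> K"
        using inK[of a 1] inK[of b 1] by (simp_all add: u_def v_def)
      ultimately show "\<exists>u\<in>K. \<exists>v\<in>K. u \<noteq> v \<and> N u < \<delta> \<and> N v < \<delta> \<and>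
          (D u - D v) / (u - v) = of_rat (of_nat e * \<alpha> p)"
        using Nu Nv by blast
    qed
    then show False
      using val[of 0] val[of 1] \<alpha>p by simp
  qed
qed

end
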